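(* Let $V$ be a vertex operator algebra over $\mathbb{C}$, let $n$ be a nonnegative integer, let $W$ be a weak $V$-module and let $U$ be a complex vector space. Set $A'_n(W)=W/O'_n(W)$, and regard $\mathrm{Hom}(A'_n(W),U)$ as the subspace of $\mathrm{Hom}(W,U)$ consisting of the linear maps vanishing on $O'_n(W)$. Then, as subspaces of $\mathrm{Hom}(W,U)$, $$\mathrm{Hom}(A'_n(W),U)=\Omega_n(\mathcal{D}_{P(-1)}(W,U),Y^L)\cap \Omega_n(\mathcal{D}_{P(-1)}(W,U),Y^R).$$ Furthermore, the elements $\alpha$ of $\mathrm{Hom}(A'_n(W),U)$ are exactly those $\alpha\in \mathrm{Hom}(W,U)$ such that $$x^{\mathrm{wt}\, v+n}(x+1)^{\mathrm{wt}\, v+n}\,\alpha Y^{o}(v,x)\in (\mathrm{Hom}(W,U))[[x]]$$ for every homogeneous $v\in V$.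
   Context: **Vertex operator algebra notation.** $V=(V,Y,\mathbf 1,\omega)$ is a vertex operator algebra over $\mathbb{C}$, with $Y(v,x)=\sum_{m\in\mathbb{Z}}v_m x^{-m-1}$, $Y(\omega,x)=\sum_{m\in\mathbb{Z}}L(m)x^{-m-2}$; $V$ is graded by $L(0)$-eigenvalues, and $\mathrm{wt}\,v$ is the weight of a homogeneous vector $v$. A weak $V$-module is a vector space $W$ with a linear map $v\mapsto Y_W(v,x)=\sum_m v_m x^{-m-1}\in \mathrm{Hom}(W,W((x)))$ satisfying all the axioms of a module (vacuum property $Y_W(\mathbf 1,x)=1$, Jacobi identity, etc.) except that no grading is required; $Y_W$ is often written $Y$, and $L(m)$ also denotes the coefficients of $Y_W(\omega,x)$. **Formal conventions.** For $k\in\mathbb{Z}$, $(x+a)^k$ is expanded in nonnegative powers of the second summand: $(x\pm 1)^k=\sum_{i\ge0}\binom{k}{i}(\pm1)^i x^{k-i}$, $(\pm 1+x)^k=\sum_{i\ge 0}\binom{k}{i}(\pm1)^{k-i}x^i$. $\mathrm{Res}_x$ is the coefficient of $x^{-1}$. **$O'_n(W)$.** $O'_n(W)$ is the linear span of the elements $\mathrm{Res}_x x^{-2n-2}(1+x)^{\mathrm{wt}\,v+n}Y(v,x)w$ for $w\in W$ and homogeneous $v\in V$. **$Y^o$ and $\mathcal{D}_{P(-1)}(W,U)$.** For $v\in V$, $Y^o(v,x)=Y(e^{xL(1)}(-x^{-2})^{L(0)}v,x^{-1})\in \mathrm{Hom}(W,W((x^{-1})))$; $Y^o(v,x-1)w=(Y^o(v,y)w)|_{y=x-1}$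 (where each power $y^k$, $k\in\mathbb{Z}$, is replaced by $(x-1)^k=\sum_{i\ge0}\binom{k}{i}(-1)^i x^{k-i}$, giving an element of $W((x^{-1}))$). $\mathcal{D}_{P(-1)}(W,U)$ is the subspace of those $f\in\mathrm{Hom}(W,U)$ such that for every $v\in V$ there exist $k,l\in\mathbb{N}$ with $(x+1)^k x^l fY^o(v,x)\in(\mathrm{Hom}(W,U))[[x]]$ (equivalently $(x+1)^kx^l fY^o(v,x)w\in U[x]$ for all $w\in W$). For such $f,v,k,l$ and $w\in W$, define $$(Y^{L}(v,x)f)(w)=(-1+x)^{-l}\big((x-1)^{l}f(Y^o(v,x-1)w)\big),$$ $$(Y^{R}(v,x)f)(w)=(1+x)^{-k}\big((x+1)^{k}f(Y^o(v,x)w)\big).$$ These are independent of the choice of $k,l$, and it is known that $Y^L$ and $Y^R$ give two commuting weak $V$-module structures on $\mathcal{D}_{P(-1)}(W,U)$. **$\Omega_n$.** For a weak $V$-module $(E,Y_E)$, $\Omega_n(E)=\Omega_n(E,Y_E)=\{e\in E: v_{\mathrm{wt}\,v+m}e=0 \text{ for all homogeneous } v\in V \text{ and all } m\ge n\}$, where $v_m$ are the coefficients of $Y_E(v,x)$. *)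

theory Defs
  imports Complex_Main "HOL-Library.Groups_Big_Fun" "HOL-Library.Function_Algebras"
begin

text \<open>
  A formal series \<open>\<Sum>j. b\<^sub>j x\<^sup>j\<close> in \<open>U[[x,x\<^sup>-\<^sup>1]]\<close> is the function \<open>j \<mapsto> b\<^sub>j\<close> of type
  \<open>int \<Rightarrow> 'u\<close>. Infinite sums are rendered by \<^const>\<open>Sum_any\<close>, which is the ordinary sum when the
  support is finite (and 0 otherwise); every sum below has finite support under the standing
  hypotheses.
\<close>

definition x_pow :: "int \<Rightarrow> int \<Rightarrow> complex" where
  "x_pow k = (\<lambda>j. if j = k then 1 else 0)"

text \<open>\<open>(x + a)\<^sup>k = \<Sum>i\<ge>0. binom(k,i) a\<^sup>i x\<^sup>k\<^sup>-\<^sup>i\<close>\<close>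
definition x_plus_pow :: "complex \<Rightarrow> int \<Rightarrow> int \<Rightarrow> complex" where
  "x_plus_pow a k =
     (\<lambda>j. if j \<le> k then (of_int k gchoose nat (k - j)) * a ^ nat (k - j) else 0)"

text \<open>\<open>(a + x)\<^sup>k = \<Sum>i\<ge>0. binom(k,i) a\<^sup>k\<^sup>-\<^sup>i x\<^sup>i\<close>\<close>
definition plus_x_pow :: "complex \<Rightarrow> int \<Rightarrow> int \<Rightarrow> complex" where
  "plus_x_pow a k =
     (\<lambda>j. if 0 \<le> j then (of_int k gchoose nat j) * a powi (k - j) else 0)"

definition series_mult ::
  "(complex \<Rightarrow> 'u \<Rightarrow> 'u::ab_group_add) \<Rightarrow> (int \<Rightarrow> complex) \<Rightarrow> (int \<Rightarrow> 'u) \<Rightarrow> int \<Rightarrow> 'u" where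
  "series_mult s a b = (\<lambda>j. Sum_any (\<lambda>i. s (a i) (b (j - i))))"

text \<open>The substitution \<open>y = x + a\<close> in \<open>\<Sum>k. b\<^sub>k y\<^sup>k\<close>, with \<open>(x + a)\<^sup>k\<close> expanded as in
  \<^const>\<open>x_plus_pow\<close>.\<close>
definition series_subst ::
  "(complex \<Rightarrow> 'u \<Rightarrow> 'u::ab_group_add) \<Rightarrow> complex \<Rightarrow> (int \<Rightarrow> 'u) \<Rightarrow> int \<Rightarrow> 'u" where
  "series_subst s a b = (\<lambda>j. Sum_any (\<lambda>k. s (x_plus_pow a k j) (b k)))"

definition Res :: "(int \<Rightarrow> 'u) \<Rightarrow> 'u" where
  "Res b = b (- 1)"

definition is_power_series :: "(int \<Rightarrow> 'u::zero) \<Rightarrow> bool" where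
  "is_power_series b \<longleftrightarrow> (\<forall>j<0. b j = 0)"


text \<open>\<open>act W v m w\<close> is \<open>v\<^sub>m w\<close>, where \<open>Y\<^sub>W(v,x) = \<Sum>m. v\<^sub>m x\<^sup>-\<^sup>m\<^sup>-\<^sup>1\<close>. The underlying vector space is
  the whole type \<open>'w\<close> with scalar multiplication \<open>scl W\<close>.\<close>
record ('v, 'w) vmodule =
  scl :: "complex \<Rightarrow> 'w \<Rightarrow> 'w"
  act :: "'v \<Rightarrow> int \<Rightarrow> 'w \<Rightarrow> 'w"

text \<open>A vertex operator algebra carries its own action on itself as the adjoint module.\<close>
record 'v voa = "('v, 'v) vmodule" +
  vac :: 'v
  conf :: 'v

definition field_series :: "('v, 'w, 'z) vmodule_scheme \<Rightarrow> 'v \<Rightarrow> 'w \<Rightarrow> int \<Rightarrow> 'w" where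
  "field_series W v w = (\<lambda>j. act W v (- j - 1) w)"

text \<open>\<open>L(m)\<close> on \<open>W\<close>, from \<open>Y(\<omega>,x) = \<Sum>m. L(m) x\<^sup>-\<^sup>m\<^sup>-\<^sup>2\<close>\<close>
definition Lop :: "'v voa \<Rightarrow> ('v, 'w, 'z) vmodule_scheme \<Rightarrow> int \<Rightarrow> 'w \<Rightarrow> 'w" where
  "Lop V W m = act W (conf V) (m + 1)"

text \<open>The homogeneous vectors of weight \<open>h\<close>. The zero vector is homogeneous of every weight.\<close>
definition weight_space :: "'v voa \<Rightarrow> int \<Rightarrow> 'v set" where
  "weight_space V h = {v. Lop V V 0 v = scl V (of_int h) v}"

text \<open>The coefficient of \<open>x\<^sub>0\<^sup>-\<^sup>l\<^sup>-\<^sup>1 x\<^sub>1\<^sup>-\<^sup>m\<^sup>-\<^sup>1 x\<^sub>2\<^sup>-\<^sup>n\<^sup>-\<^sup>1\<close> in the Jacobi identity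
  \<open>x\<^sub>0\<^sup>-\<^sup>1\<delta>((x\<^sub>1-x\<^sub>2)/x\<^sub>0) Y(u,x\<^sub>1)Y(v,x\<^sub>2)w - x\<^sub>0\<^sup>-\<^sup>1\<delta>((x\<^sub>2-x\<^sub>1)/(-x\<^sub>0)) Y(v,x\<^sub>2)Y(u,x\<^sub>1)w
    = x\<^sub>2\<^sup>-\<^sup>1\<delta>((x\<^sub>1-x\<^sub>0)/x\<^sub>2) Y(Y(u,x\<^sub>0)v,x\<^sub>2)w\<close>.\<close>
definition jacobi_identity ::
  "'v voa \<Rightarrow> ('v, 'w::ab_group_add, 'z) vmodule_scheme \<Rightarrow> bool" where
  "jacobi_identity V W \<longleftrightarrow> (\<forall>u v w. \<forall>l m n :: int.
     Sum_any (\<lambda>i::nat. scl W ((- 1) ^ i * (of_int l gchoose i))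
                 (act W u (m + l - int i) (act W v (n + int i) w)))
   - Sum_any (\<lambda>i::nat. scl W ((- 1) powi l * ((- 1) ^ i * (of_int l gchoose i)))
                 (act W v (n + l - int i) (act W u (m + int i) w)))
   = Sum_any (\<lambda>i::nat. scl W (of_int m gchoose i)
                 (act W (act V u (l + int i) v) (m + n - int i) w)))"

text \<open>Linearity, lower truncation (\<open>Y(v,x)w \<in> W((x))\<close>), the vacuum property, the Jacobi identity and
  the \<open>L(-1)\<close>-derivative property \<open>Y(L(-1)v,x) = d/dx Y(v,x)\<close>. When \<open>V\<close> is a vertex operator algebra,
  the Virasoro relations on \<open>W\<close> are a consequence of the Jacobi identity.\<close>
definition weak_module ::
  "'v::ab_group_add voa \<Rightarrow> ('v, 'w::ab_group_add, 'z) vmodule_scheme \<Rightarrow> bool" where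
  "weak_module V W \<longleftrightarrow>
     vector_space (scl W) \<and>
     (\<forall>m w. Vector_Spaces.linear (scl V) (scl W) (\<lambda>v. act W v m w)) \<and>
     (\<forall>v m. Vector_Spaces.linear (scl W) (scl W) (act W v m)) \<and>
     (\<forall>v w. \<exists>N. \<forall>m\<ge>N. act W v m w = 0) \<and>
     (\<forall>m w. act W (vac V) m w = (if m = - 1 then w else 0)) \<and>
     jacobi_identity V W \<and>
     (\<forall>v m w. act W (Lop V V (- 1) v) m w = scl W (- of_int m) (act W v (m - 1) w))"

text \<open>The grading is \<open>V = \<Oplus>h\<in>\<int>. V\<^sub>h\<close> by \<open>L(0)\<close>-eigenspaces; the sum of these is automatically direct.\<close>
definition vertex_operator_algebra :: "'v::ab_group_add voa \<Rightarrow> bool" where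
  "vertex_operator_algebra V \<longleftrightarrow>
     vector_space (scl V) \<and>
     weak_module V V \<and>
     (\<forall>v. act V v (- 1) (vac V) = v \<and> (\<forall>m\<ge>0. act V v m (vac V) = 0)) \<and>
     (\<exists>c::complex. \<forall>m n v.
        Lop V V m (Lop V V n v) - Lop V V n (Lop V V m v)
        = scl V (of_int (m - n)) (Lop V V (m + n) v)
          + (if m + n = 0 then scl V (c * of_int (m ^ 3 - m) / 12) v else 0)) \<and>
     module.span (scl V) (\<Union>h. weight_space V h) = UNIV \<and>
     (\<forall>h. \<exists>B. finite B \<and> weight_space V h \<subseteq> module.span (scl V) B) \<and>
     (\<exists>N. \<forall>h<N. weight_space V h = {0})"

definition weight_component :: "'v::ab_group_add voa \<Rightarrow> int \<Rightarrow> 'v \<Rightarrow> 'v" where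
  "weight_component V h v =
     (THE c. (\<forall>k. c k \<in> weight_space V k) \<and> finite {k. c k \<noteq> 0} \<and> v = Sum_any c) h"


definition O' ::
  "'v voa \<Rightarrow> ('v, 'w::ab_group_add) vmodule \<Rightarrow> nat \<Rightarrow> 'w set" where
  "O' V W n = module.span (scl W)
     {Res (series_mult (scl W) (x_pow (- 2 * int n - 2))
            (series_mult (scl W) (plus_x_pow 1 (h + int n)) (field_series W v w)))
      | h v w. v \<in> weight_space V h}"

text \<open>\<open>Hom(W/O'\<^sub>n(W), U)\<close> as a subspace of \<open>Hom(W,U)\<close>\<close>
definition Hom_A' ::
  "'v voa \<Rightarrow> ('v, 'w::ab_group_add) vmodule \<Rightarrow> (complex \<Rightarrow> 'u \<Rightarrow> 'u::ab_group_add) \<Rightarrow> nat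
    \<Rightarrow> ('w \<Rightarrow> 'u) set" where
  "Hom_A' V W sU n = {f. Vector_Spaces.linear (scl W) sU f \<and> (\<forall>w\<in>O' V W n. f w = 0)}"

text \<open>The coefficient of \<open>x\<^sup>j\<close> in \<open>e\<^sup>x\<^sup>L\<^sup>(\<^sup>1\<^sup>) (-x\<^sup>-\<^sup>2)\<^sup>L\<^sup>(\<^sup>0\<^sup>) v\<close>: a component \<open>v\<^sub>h\<close> of weight \<open>h\<close> contributes
  \<open>\<Sum>i\<ge>0. (-1)\<^sup>h x\<^sup>i\<^sup>-\<^sup>2\<^sup>h L(1)\<^sup>i v\<^sub>h / i!\<close>, so \<open>i = j + 2h\<close>.\<close>
definition opp_vec :: "'v::ab_group_add voa \<Rightarrow> 'v \<Rightarrow> int \<Rightarrow> 'v" where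
  "opp_vec V v = (\<lambda>j. Sum_any (\<lambda>h.
     if 0 \<le> j + 2 * h
     then scl V ((- 1) powi h / fact (nat (j + 2 * h)))
            ((Lop V V 1 ^^ nat (j + 2 * h)) (weight_component V h v))
     else 0))"

text \<open>\<open>Y\<^sup>o(v,x)w = \<Sum>j. x\<^sup>j Y(opp_vec V v j, x\<^sup>-\<^sup>1)w\<close>, where \<open>Y(u,x\<^sup>-\<^sup>1) = \<Sum>m. u\<^sub>m x\<^sup>m\<^sup>+\<^sup>1\<close>\<close>
definition Yo ::
  "'v::ab_group_add voa \<Rightarrow> ('v, 'w::ab_group_add) vmodule \<Rightarrow> 'v \<Rightarrow> 'w \<Rightarrow> int \<Rightarrow> 'w" where
  "Yo V W v w = (\<lambda>k. Sum_any (\<lambda>j. act W (opp_vec V v j) (k - j - 1) w))"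

text \<open>\<open>x\<^sup>l (x+1)\<^sup>k f Y\<^sup>o(v,x) \<in> Hom(W,U)[[x]]\<close>. For \<open>k < 0\<close> the product with the series
  \<open>(x+1)\<^sup>k \<in> \<complex>((x\<^sup>-\<^sup>1))\<close> is only defined after applying it to a vector \<open>w\<close>, hence the pointwise form.\<close>
definition clears_poles ::
  "'v::ab_group_add voa \<Rightarrow> ('v, 'w::ab_group_add) vmodule \<Rightarrow> (complex \<Rightarrow> 'u \<Rightarrow> 'u::ab_group_add)
    \<Rightarrow> ('w \<Rightarrow> 'u) \<Rightarrow> 'v \<Rightarrow> int \<Rightarrow> int \<Rightarrow> bool" where
  "clears_poles V W sU f v k l \<longleftrightarrow>
     (\<forall>w. is_power_series (series_mult sU (x_pow l)
            (series_mult sU (x_plus_pow 1 k) (f \<circ> Yo V W v w))))"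

text \<open>\<open>D\<^sub>P\<^sub>(\<^sub>-\<^sub>1\<^sub>)(W,U)\<close>\<close>
definition DP ::
  "'v::ab_group_add voa \<Rightarrow> ('v, 'w::ab_group_add) vmodule \<Rightarrow> (complex \<Rightarrow> 'u \<Rightarrow> 'u::ab_group_add)
    \<Rightarrow> ('w \<Rightarrow> 'u) set" where
  "DP V W sU = {f. Vector_Spaces.linear (scl W) sU f \<and>
     (\<forall>v. \<exists>k l :: nat. clears_poles V W sU f v (int k) (int l))}"

text \<open>\<open>YL V W sU v m f\<close> and \<open>YR V W sU v m f\<close> are the coefficients of \<open>x\<^sup>-\<^sup>m\<^sup>-\<^sup>1\<close> in \<open>Y\<^sup>L(v,x)f\<close> and
  \<open>Y\<^sup>R(v,x)f\<close>. They do not depend on the chosen \<open>k, l\<close>, and are meaningful only for \<open>f \<in> DP V W sU\<close>.\<close>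
definition YL ::
  "'v::ab_group_add voa \<Rightarrow> ('v, 'w::ab_group_add) vmodule \<Rightarrow> (complex \<Rightarrow> 'u \<Rightarrow> 'u::ab_group_add)
    \<Rightarrow> 'v \<Rightarrow> int \<Rightarrow> ('w \<Rightarrow> 'u) \<Rightarrow> 'w \<Rightarrow> 'u" where
  "YL V W sU v m f = (\<lambda>w.
     let l = (SOME l::nat. \<exists>k::nat. clears_poles V W sU f v (int k) (int l))
     in series_mult sU (plus_x_pow (- 1) (- int l))
          (series_mult sU (x_plus_pow (- 1) (int l))
             (f \<circ> series_subst (scl W) (- 1) (Yo V W v w))) (- m - 1))"

definition YR ::
  "'v::ab_group_add voa \<Rightarrow> ('v, 'w::ab_group_add) vmodule \<Rightarrow> (complex \<Rightarrow> 'u \<Rightarrow> 'u::ab_group_add)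
    \<Rightarrow> 'v \<Rightarrow> int \<Rightarrow> ('w \<Rightarrow> 'u) \<Rightarrow> 'w \<Rightarrow> 'u" where
  "YR V W sU v m f = (\<lambda>w.
     let k = (SOME k::nat. \<exists>l::nat. clears_poles V W sU f v (int k) (int l))
     in series_mult sU (plus_x_pow 1 (- int k))
          (series_mult sU (x_plus_pow 1 (int k)) (f \<circ> Yo V W v w)) (- m - 1))"

text \<open>\<open>\<Omega>\<^sub>n(E,Y\<^sub>E)\<close>, for \<open>Y\<^sub>E\<close> given by its coefficients \<open>YE v m = v\<^sub>m\<close>\<close>
definition Omega ::
  "'v voa \<Rightarrow> nat \<Rightarrow> 'e::zero set \<Rightarrow> ('v \<Rightarrow> int \<Rightarrow> 'e \<Rightarrow> 'e) \<Rightarrow> 'e set" where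
  "Omega V n E YE =
     {e\<in>E. \<forall>h. \<forall>v\<in>weight_space V h. \<forall>m\<ge>int n. YE v (h + m) e = 0}"

end

theory Submission
  imports Defs
begin

text \<open>Fix a linear \<open>f : W \<rightarrow> U\<close>, a homogeneous \<open>v\<close> of weight \<open>h\<close>, and put \<open>N = h + n\<close>. All three
  conditions turn out to be statements about the single family of series
  \<open>F(x) = f Y\<^sup>o(v,x)w\<close>, which lie in \<open>U((x\<^sup>-\<^sup>1))\<close>.

  \<^bold>\<open>The two module structures.\<close> For \<open>f\<close> in \<open>D\<^sub>P\<^sub>(\<^sub>-\<^sub>1\<^sub>)(W,U)\<close> the series \<open>F\<close> is the expansion at
  infinity of a rational function with no finite poles other than \<open>0\<close> and \<open>-1\<close>. \<open>Y\<^sup>R\<close> re-expands it at \<open>0\<close>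
  and \<open>Y\<^sup>L\<close> at \<open>-1\<close>, so \<open>f\<close> lies in \<open>\<Omega>\<^sub>n\<close> for \<open>Y\<^sup>R\<close> when the pole at \<open>0\<close> has order at most \<open>N\<close>, and
  in \<open>\<Omega>\<^sub>n\<close> for \<open>Y\<^sup>L\<close> when the pole at \<open>-1\<close> does. Since pole orders at two different points are
  bounded independently (\<open>clears_rectangle\<close>), both bounds together say that
  \<open>x\<^sup>N (x+1)\<^sup>N F(x)\<close> is a power series. No rational functions appear below: the factor \<open>(x+1)\<^sup>k\<close>
  enters only through Pascal's rule \<open>(x+1)\<^sup>k\<^sup>+\<^sup>1 = (x+1)\<^sup>k + x (x+1)\<^sup>k\<close>, and the substitution
  \<open>y = x - 1\<close> only through the fact that the coefficient of \<open>x\<^sup>j\<close> in \<open>F(x-1)\<close> is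
  \<open>Res\<^sub>y (y+1)\<^sup>-\<^sup>j\<^sup>-\<^sup>1 F(y)\<close>.

  \<^bold>\<open>The quotient by O'.\<close> By definition \<open>f\<close> kills \<open>O'\<^sub>n(W)\<close> when
  \<open>Res\<^sub>x x\<^sup>m (1+x)\<^sup>h\<^sup>+\<^sup>n f Y(v,x)w = 0\<close> for \<open>m = -2n-2\<close>. Applying this to \<open>L(-1)v\<close>, whose field is
  \<open>d/dx Y(v,x)\<close>, and integrating by parts yields the same for every \<open>m \<le> -2n-2\<close>
  (\<open>vanishes_on_O'_iff_vanishes_on_modes\<close>). On the other hand, with \<open>y = x\<^sup>-\<^sup>1\<close>,
  \<open>x\<^sup>N (x+1)\<^sup>N f Y\<^sup>o(v,x) = \<Sum>i. (-1)\<^sup>h/i! y\<^sup>-\<^sup>2\<^sup>n\<^sup>-\<^sup>i (1+y)\<^sup>h\<^sup>+\<^sup>n f Y(L(1)\<^sup>i v, y)\<close>.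
  Here \<open>L(1)\<^sup>i v\<close> has weight \<open>h - i\<close>, and expanding the spare factor \<open>(1+y)\<^sup>i\<close> shows that the
  coefficients of negative powers of \<open>x\<close> are combinations of the residues above for \<open>L(1)\<^sup>i v\<close>.
  The term \<open>i = 0\<close> is the residue for \<open>v\<close> itself, so induction on the weight, which is bounded
  below, recovers the residues from the coefficients (\<open>vanishes_on_O'_iff_clears_poles\<close>).\<close>

section \<open>Binomial operators on formal series\<close>

text \<open>The operator \<open>(1 + c S)\<^sup>a\<close>, where \<open>S\<close> is the shift \<open>(S b) m = b (m + 1)\<close>. For the generating
  function \<open>b(x) = \<Sum>m. b m x\<^sup>-\<^sup>m\<^sup>-\<^sup>1\<close> its value at \<open>m\<close> is \<open>Res\<^sub>x x\<^sup>m (1 + c x)\<^sup>a b(x)\<close>. Products with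
  \<open>(x + c)\<^sup>k\<close> and \<open>(1 + x)\<^sup>k\<close> and the substitution \<open>y = x - 1\<close> are, up to
  reindexing, all of this form, so one Pascal rule serves for all of them.\<close>
definition binom_shift ::
  "(complex \<Rightarrow> 'u \<Rightarrow> 'u::ab_group_add) \<Rightarrow> complex \<Rightarrow> int \<Rightarrow> (int \<Rightarrow> 'u) \<Rightarrow> int \<Rightarrow> 'u" where
  "binom_shift s c a b m = Sum_any (\<lambda>t::nat. s ((of_int a gchoose t) * c ^ t) (b (m + int t)))"

text \<open>For coefficients \<open>b j\<close> of \<open>x\<^sup>j\<close> this says that the series lies in \<open>U((x\<^sup>-\<^sup>1))\<close>; for modes
  \<open>b m = v\<^sub>m w\<close> it is lower truncation.\<close>
definition bounded_above :: "(int \<Rightarrow> 'u::zero) \<Rightarrow> bool" where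
  "bounded_above b \<longleftrightarrow> (\<exists>K. \<forall>j\<ge>K. b j = 0)"

lemma bounded_aboveI: "(\<And>j. j \<ge> K \<Longrightarrow> b j = 0) \<Longrightarrow> bounded_above b"
  unfolding bounded_above_def by blast

lemma bounded_above_shift: "bounded_above b \<Longrightarrow> bounded_above (\<lambda>j. b (j + d))"
  unfolding bounded_above_def by (metis add_le_cancel_right diff_add_cancel)

lemma bounded_above_sum:
  assumes "finite I" "\<And>i. i \<in> I \<Longrightarrow> bounded_above (b i)"
  shows "bounded_above (\<lambda>j. \<Sum>i\<in>I. b i j)"
  using assms
proof (induction I)
  case (insert i I)
  obtain K where "\<And>j. j \<ge> K \<Longrightarrow> (\<Sum>i\<in>I. b i j) = 0"
    using insert unfolding bounded_above_def by auto
  moreover obtain K' where "\<And>j. j \<ge> K' \<Longrightarrow> b i j = 0"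
    using insert.prems unfolding bounded_above_def by auto
  ultimately show ?case
    using insert.hyps by (intro bounded_aboveI[of "max K K'"]) simp
qed (simp add: bounded_above_def)

lemma Sum_any_reindex_range:
  fixes g :: "'a \<Rightarrow> 'u::comm_monoid_add"
  assumes "inj r" "\<And>a. a \<notin> range r \<Longrightarrow> g a = 0"
  shows "Sum_any g = Sum_any (\<lambda>t. g (r t))"
proof -
  have "{a. g a \<noteq> 0} = r ` {t. g (r t) \<noteq> 0}"
    using assms(2) by fastforce
  moreover have "inj_on r {t. g (r t) \<noteq> 0}"
    using assms(1) inj_on_subset by blast
  ultimately show ?thesis
    by (simp add: Sum_any.expand_set sum.reindex)
qed

lemma Sum_any_eq_sum_lessThan:
  fixes g :: "nat \<Rightarrow> 'u::comm_monoid_add"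
  assumes "\<And>t. t \<ge> K \<Longrightarrow> g t = 0"
  shows "Sum_any g = (\<Sum>t<K. g t)"
  by (rule Sum_any.expand_superset) (use assms in \<open>auto simp: not_le[symmetric]\<close>)

locale complex_space = vector_space scale
  for scale :: "complex \<Rightarrow> 'u \<Rightarrow> 'u::ab_group_add"
begin

lemma bounded_above_from:
  assumes "bounded_above b"
  obtains K where "\<And>t. t \<ge> K \<Longrightarrow> b (m + int t) = 0"
proof -
  obtain J where J: "\<And>j. j \<ge> J \<Longrightarrow> b j = 0" using assms unfolding bounded_above_def by blast
  have "b (m + int t) = 0" if "t \<ge> nat (J - m)" for t
    by (rule J) (use that in linarith)
  then show ?thesis by (rule that)
qed

lemma binom_shift_eq_sum:
  assumes "\<And>t. t \<ge> K \<Longrightarrow> b (m + int t) = 0"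
  shows "binom_shift scale c a b m = (\<Sum>t<K. scale ((of_int a gchoose t) * c ^ t) (b (m + int t)))"
  unfolding binom_shift_def by (rule Sum_any_eq_sum_lessThan) (simp add: assms)

lemma binom_shift_pascal:
  assumes "bounded_above b"
  shows "binom_shift scale c (a + 1) b m
         = binom_shift scale c a b m + scale c (binom_shift scale c a b (m + 1))"
proof -
  obtain K where K: "\<And>t. t \<ge> K \<Longrightarrow> b (m + int t) = 0"
    using bounded_above_from[OF assms, of m] by metis
  have K1: "b (m + 1 + int t) = 0" if "t \<ge> K" for t
    using K[of "Suc t"] that by (simp add: algebra_simps)
  have K2: "b (m + int t) = 0" if "t \<ge> Suc K" for t
    using K that by simp
  have pascal: "(of_int (a + 1) gchoose Suc t :: complex)
      = (of_int a gchoose t) + (of_int a gchoose Suc t)" for t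
    using gbinomial_Suc_Suc[of "of_int a :: complex" t] by simp
  have idx: "m + int (Suc t) = m + 1 + int t" for t by simp
  have sum0: "binom_shift scale c a' b m
      = (\<Sum>t<Suc K. scale ((of_int a' gchoose t) * c ^ t) (b (m + int t)))" for a'
    by (rule binom_shift_eq_sum) (rule K2)
  have sum1: "binom_shift scale c a b (m + 1)
      = (\<Sum>t<K. scale ((of_int a gchoose t) * c ^ t) (b (m + 1 + int t)))"
    by (rule binom_shift_eq_sum) (rule K1)
  show ?thesis
    unfolding sum0 sum1
      sum.lessThan_Suc_shift idx pascal scale_sum_right
    by (simp add: sum.distrib distrib_left distrib_right scale_left_distrib ac_simps)
qed

lemma binom_shift_0 [simp]: "binom_shift scale c 0 b m = b m"
proof -
  have "binom_shift scale c 0 b m = Sum_any (\<lambda>t::nat. if t = 0 then b m else 0)"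
    unfolding binom_shift_def by (rule Sum_any.cong) (auto simp: gbinomial_0_left)
  then show ?thesis by simp
qed

text \<open>Each further factor \<open>1 + x\<close> brings in the next residue as well, so the range of vanishing shrinks
  by one.\<close>
lemma binom_shift_vanishing_add:
  assumes "bounded_above b" "\<And>m. m \<le> M \<Longrightarrow> binom_shift scale 1 a b m = 0"
  shows "m \<le> M - int i \<Longrightarrow> binom_shift scale 1 (a + int i) b m = 0"
proof (induction i arbitrary: m)
  case (Suc i)
  have "binom_shift scale 1 (a + int i + 1) b m = 0"
    unfolding binom_shift_pascal[OF assms(1)] using Suc by simp
  then show ?case by (simp add: ac_simps)
qed (use assms in simp)

text \<open>Integration by parts: with \<open>b(x) = \<Sum>m. b m x\<^sup>-\<^sup>m\<^sup>-\<^sup>1\<close>, the coefficients \<open>- i b (i - 1)\<close> are those of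
  \<open>b'(x)\<close>, and \<open>Res x\<^sup>m (1+x)\<^sup>a\<^sup>+\<^sup>1 b' = - Res (x\<^sup>m (1+x)\<^sup>a\<^sup>+\<^sup>1)' b\<close>.\<close>
lemma binom_shift_derivative:
  assumes "bounded_above b"
  shows "binom_shift scale 1 (a + 1) (\<lambda>i. scale (- of_int i) (b (i - 1))) m
       = - (scale (of_int m) (binom_shift scale 1 (a + 1) b (m - 1))
            + scale (of_int (a + 1)) (binom_shift scale 1 a b m))"
proof -
  obtain K where K: "\<And>t. t \<ge> K \<Longrightarrow> b (m + int t) = 0"
    using bounded_above_from[OF assms, of m] by metis
  have K': "b (m - 1 + int t) = 0" if "t \<ge> Suc K" for t
    using K[of "t - 1"] that by (simp add: of_nat_diff algebra_simps)
  have K'': "scale (- of_int (m + int t)) (b (m + int t - 1)) = 0" if "t \<ge> Suc K" for t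
    using K'[OF that] by (simp add: algebra_simps)
  define C :: "nat \<Rightarrow> complex" where "C t = (of_int (a + 1) gchoose t)" for t
  have "binom_shift scale 1 (a + 1) (\<lambda>i. scale (- of_int i) (b (i - 1))) m
      = (\<Sum>t<Suc K. scale (C t) (scale (- of_int (m + int t)) (b (m + int t - 1))))"
    unfolding C_def by (subst binom_shift_eq_sum[where K = "Suc K"]) (use K'' in simp_all)
  also have "\<dots> = - (\<Sum>t<Suc K. scale (of_int m) (scale (C t) (b (m - 1 + int t)))
      + scale (of_nat t * C t) (b (m - 1 + int t)))"
    unfolding sum_negf[symmetric]
  proof (rule sum.cong)
    fix t
    have "m + int t - 1 = m - 1 + int t" by simp
    then show "scale (C t) (scale (- of_int (m + int t)) (b (m + int t - 1)))
      = - (scale (of_int m) (scale (C t) (b (m - 1 + int t)))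
      + scale (of_nat t * C t) (b (m - 1 + int t)))"
      by (simp only:) (simp add: scale_left_distrib scale_left_diff_distrib scale_right_diff_distrib mult.commute)
  qed simp
  also have "\<dots> = - (scale (of_int m) (\<Sum>t<Suc K. scale (C t) (b (m - 1 + int t)))
      + (\<Sum>t<Suc K. scale (of_nat t * C t) (b (m - 1 + int t))))"
    by (simp only: sum.distrib scale_sum_right)
  also have "(\<Sum>t<Suc K. scale (C t) (b (m - 1 + int t))) = binom_shift scale 1 (a + 1) b (m - 1)"
    unfolding C_def by (subst binom_shift_eq_sum[where K = "Suc K"]) (use K' in simp_all)
  also have "(\<Sum>t<Suc K. scale (of_nat t * C t) (b (m - 1 + int t)))
      = (\<Sum>t<K. scale (of_nat (Suc t) * C (Suc t)) (b (m + int t)))"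
    unfolding sum.lessThan_Suc_shift by simp
  also have "\<dots> = (\<Sum>t<K. scale (of_int (a + 1)) (scale (of_int a gchoose t) (b (m + int t))))"
  proof (rule sum.cong)
    fix t
    have "of_nat (Suc t) * C (Suc t) = of_int (a + 1) * (of_int a gchoose t)"
      using Suc_times_gbinomial[of t "of_int a :: complex"] by (simp add: C_def)
    then show "scale (of_nat (Suc t) * C (Suc t)) (b (m + int t))
       = scale (of_int (a + 1)) (scale (of_int a gchoose t) (b (m + int t)))"
      by (simp only: scale_scale)
  qed simp
  also have "\<dots> = scale (of_int (a + 1)) (binom_shift scale 1 a b m)"
    unfolding scale_sum_right[symmetric]
    by (subst binom_shift_eq_sum[where K = K]) (use K in simp_all)
  finally show ?thesis .
qed

lemma binom_shift_translate:
  "binom_shift scale c a (\<lambda>j. b (j + d)) m = binom_shift scale c a b (m + d)"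
  unfolding binom_shift_def by (simp add: ac_simps)

lemma binom_shift_sum:
  assumes "\<And>i. i \<in> I \<Longrightarrow> bounded_above (b i)" "finite I"
  shows "binom_shift scale c a (\<lambda>j. \<Sum>i\<in>I. scale (\<gamma> i) (b i j)) m
    = (\<Sum>i\<in>I. scale (\<gamma> i) (binom_shift scale c a (b i) m))"
proof -
  have "\<exists>K. \<forall>i\<in>I. \<forall>t\<ge>K. b i (m + int t) = 0"
    using assms(2,1)
  proof (induction I)
    case (insert i I)
    obtain K where "\<forall>i\<in>I. \<forall>t\<ge>K. b i (m + int t) = 0" using insert by auto
    moreover obtain K' where "\<And>t. t \<ge> K' \<Longrightarrow> b i (m + int t) = 0"
      using bounded_above_from insert.prems by (metis insertI1)
    ultimately show ?case by (intro exI[of _ "max K K'"]) auto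
  qed simp
  then obtain K where K: "\<And>i t. i \<in> I \<Longrightarrow> t \<ge> K \<Longrightarrow> b i (m + int t) = 0" by blast
  have "binom_shift scale c a (\<lambda>j. \<Sum>i\<in>I. scale (\<gamma> i) (b i j)) m =
     (\<Sum>t<K. \<Sum>i\<in>I. scale (\<gamma> i) (scale ((of_int a gchoose t) * c ^ t) (b i (m + int t))))"
    by (subst binom_shift_eq_sum[where K = K])
       (auto simp: K scale_sum_right mult.commute mult.left_commute intro!: sum.neutral)
  also have "\<dots> = (\<Sum>i\<in>I. scale (\<gamma> i) (binom_shift scale c a (b i) m))"
    by (subst sum.swap) (auto simp: scale_sum_right binom_shift_eq_sum[where K = K] K intro!: sum.cong)
  finally show ?thesis .
qed

lemma series_mult_x_pow: "series_mult scale (x_pow k) b j = b (j - k)"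
proof -
  have "series_mult scale (x_pow k) b j = Sum_any (\<lambda>i. if i = k then b (j - i) else 0)"
    unfolding series_mult_def x_pow_def by (rule Sum_any.cong) simp
  then show ?thesis by simp
qed

lemma series_mult_x_plus_pow:
  "series_mult scale (x_plus_pow c k) b j = binom_shift scale c k b (j - k)"
proof -
  have "Sum_any (\<lambda>i. scale (x_plus_pow c k i) (b (j - i)))
      = Sum_any (\<lambda>t::nat. scale (x_plus_pow c k (k - int t)) (b (j - (k - int t))))"
  proof (rule Sum_any_reindex_range)
    fix i assume "i \<notin> range (\<lambda>t. k - int t)"
    then have "\<not> i \<le> k" by (auto simp: image_iff algebra_simps zle_iff_zadd)
    then show "scale (x_plus_pow c k i) (b (j - i)) = 0" by (simp add: x_plus_pow_def)
  qed (auto simp: inj_def)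
  then show ?thesis
    unfolding series_mult_def binom_shift_def by (simp add: x_plus_pow_def algebra_simps)
qed

lemma series_mult_plus_x_pow:
  "series_mult scale (plus_x_pow c k) b j
    = Sum_any (\<lambda>t::nat. scale ((of_int k gchoose t) * c powi (k - int t)) (b (j - int t)))"
proof -
  have "Sum_any (\<lambda>i. scale (plus_x_pow c k i) (b (j - i)))
      = Sum_any (\<lambda>t::nat. scale (plus_x_pow c k (int t)) (b (j - int t)))"
  proof (rule Sum_any_reindex_range)
    fix i assume "i \<notin> range int"
    then have "\<not> 0 \<le> i" by (metis rangeI zero_le_imp_eq_int)
    then show "scale (plus_x_pow c k i) (b (j - i)) = 0" by (simp add: plus_x_pow_def)
  qed (auto simp: inj_def)
  then show ?thesis
    unfolding series_mult_def by (simp add: plus_x_pow_def)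
qed

lemma series_mult_plus_1_x_pow:
  "series_mult scale (plus_x_pow 1 k) b j = binom_shift scale 1 k (\<lambda>i. b (- i)) (- j)"
  unfolding series_mult_plus_x_pow binom_shift_def by simp

text \<open>The coefficient of \<open>x\<^sup>j\<close> in \<open>b(x-1)\<close> is the residue of \<open>(y+1)\<^sup>-\<^sup>j\<^sup>-\<^sup>1 b(y)\<close>. This identity of binomial
  coefficients is upper negation.\<close>
lemma series_subst_minus_1:
  "series_subst scale (- 1) b j = binom_shift scale 1 (- j - 1) b j"
proof -
  have "Sum_any (\<lambda>k. scale (x_plus_pow (- 1) k j) (b k))
      = Sum_any (\<lambda>t::nat. scale (x_plus_pow (- 1) (j + int t) j) (b (j + int t)))"
  proof (rule Sum_any_reindex_range)
    fix k assume "k \<notin> range (\<lambda>t. j + int t)"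
    then have "\<not> j \<le> k" by (auto simp: image_iff zle_iff_zadd)
    then show "scale (x_plus_pow (- 1) k j) (b k) = 0" by (simp add: x_plus_pow_def)
  qed (auto simp: inj_def)
  moreover have "x_plus_pow (- 1) (j + int t) j = (of_int (- j - 1) gchoose t)" for t
    using gbinomial_negated_upper[of "of_int (- j - 1) :: complex" t]
    by (simp add: x_plus_pow_def algebra_simps)
  ultimately show ?thesis
    unfolding series_subst_def binom_shift_def by simp
qed

text \<open>The series \<open>(c + x)\<^sup>k\<close> has an invertible constant term, so multiplying by it does not change the
  lowest exponent of a series in \<open>U((x))\<close>.\<close>
lemma plus_x_pow_vanishing_below:
  assumes "c \<noteq> 0" and below: "\<And>j. j < J0 \<Longrightarrow> b j = 0"
  shows "(\<forall>j<J. series_mult scale (plus_x_pow c k) b j = 0) \<longleftrightarrow> (\<forall>j<J. b j = 0)"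
proof
  assume "\<forall>j<J. b j = 0"
  then show "\<forall>j<J. series_mult scale (plus_x_pow c k) b j = 0"
    unfolding series_mult_plus_x_pow by simp
next
  assume *: "\<forall>j<J. series_mult scale (plus_x_pow c k) b j = 0"
  have "b j = 0" if "j < J" for j
    using that
  proof (induction "nat (j - J0)" arbitrary: j rule: less_induct)
    case less
    have smaller: "b i = 0" if "i < j" for i
    proof (cases "i < J0")
      case False
      show ?thesis by (rule less.hyps) (use that False less.prems in auto)
    qed (rule below)
    have "series_mult scale (plus_x_pow c k) b j
        = Sum_any (\<lambda>t::nat. if t = 0 then scale (c powi k) (b j) else 0)"
      unfolding series_mult_plus_x_pow by (rule Sum_any.cong) (auto simp: smaller)
    then have "scale (c powi k) (b j) = 0" using * less.prems by simp
    then show ?case using \<open>c \<noteq> 0\<close> by simp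
  qed
  then show "\<forall>j<J. b j = 0" by blast
qed

section \<open>Pole orders at 0 and -1\<close>

text \<open>\<open>x\<^sup>l (x+1)\<^sup>k b(x)\<close> is a power series: for the rational function that \<open>b\<close> expands, the pole at \<open>-1\<close> has order at
  most \<open>k\<close> and the pole at \<open>0\<close> order at most \<open>l\<close>.\<close>
definition clears :: "int \<Rightarrow> int \<Rightarrow> (int \<Rightarrow> 'u) \<Rightarrow> bool" where
  "clears k l b \<longleftrightarrow> (\<forall>j < - l - k. binom_shift scale 1 k b j = 0)"

lemma clears_iff:
  "clears k l b \<longleftrightarrow> is_power_series (series_mult scale (x_pow l) (series_mult scale (x_plus_pow 1 k) b))"
proof -
  have "(\<forall>j< - l - k. binom_shift scale 1 k b j = 0)
      \<longleftrightarrow> (\<forall>j<0. binom_shift scale 1 k b (j - l - k) = 0)" (is "?A \<longleftrightarrow> ?B")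
  proof
    assume ?A then show ?B by simp
  next
    assume B: ?B
    show ?A
    proof (intro allI impI)
      fix j assume "j < - l - k"
      then show "binom_shift scale 1 k b j = 0" using B[rule_format, of "j + l + k"] by simp
    qed
  qed
  then show ?thesis
    unfolding clears_def is_power_series_def series_mult_x_pow series_mult_x_plus_pow .
qed

lemma clears_sum:
  assumes "finite I" "\<And>i. i \<in> I \<Longrightarrow> bounded_above (b i)" "\<And>i. i \<in> I \<Longrightarrow> clears k l (b i)"
  shows "clears k l (\<lambda>j. \<Sum>i\<in>I. b i j)"
  using binom_shift_sum[OF assms(2,1), where c = 1 and a = k and \<gamma> = "\<lambda>_. 1"] assms(3)
  unfolding clears_def by simp

lemma clears_mono_left:
  assumes "bounded_above b" "clears k l b" "k \<le> k'"
  shows "clears k' l b"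
proof -
  have "clears (k + int i) l b" for i
  proof (induction i)
    case (Suc i)
    have "binom_shift scale 1 (k + int i + 1) b j = 0" if "j < - l - (k + int i + 1)" for j
      using Suc that unfolding binom_shift_pascal[OF assms(1)] clears_def by simp
    then show ?case unfolding clears_def by (simp add: ac_simps)
  qed (use assms in simp)
  from this[of "nat (k' - k)"] assms(3) show ?thesis by simp
qed

lemma clears_mono_right: "clears k l b \<Longrightarrow> l \<le> l' \<Longrightarrow> clears k l' b"
  unfolding clears_def by simp

text \<open>The series \<open>b\<^sub>k = (x+1)\<^sup>k b\<close> is bounded below by the first clearing hypothesis, and \<open>1 + x\<close> has constant
  term \<open>1\<close>, so \<open>b\<^sub>k\<close> starts at the same exponent as \<open>(1+x) b\<^sub>k\<close>.\<close>
lemma clears_rectangle_step: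
  assumes "bounded_above b" "clears k l b" "clears (k + 1) l' b"
  shows "clears k l' b"
proof -
  have "binom_shift scale 1 k b j = 0" if "j < - l' - k" for j
    using that
  proof (induction "nat (j - (- l - k))" arbitrary: j rule: less_induct)
    case less
    show ?case
    proof (cases "j < - l - k")
      case True
      then show ?thesis using assms(2) unfolding clears_def by simp
    next
      case False
      have "binom_shift scale 1 (k + 1) b (j - 1) = 0"
        using assms(3) less.prems unfolding clears_def by simp
      moreover have "binom_shift scale 1 k b (j - 1) = 0"
      proof (cases "j - 1 < - l - k")
        case True
        then show ?thesis using assms(2) unfolding clears_def by simp
      next
        case F: False
        show ?thesis by (rule less.hyps) (use False F less.prems in auto)
      qed
      ultimately show ?thesis using binom_shift_pascal[OF assms(1), of 1 k "j - 1"] by simp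
    qed
  qed
  then show ?thesis unfolding clears_def by blast
qed

text \<open>The pole orders at \<open>-1\<close> and at \<open>0\<close> are bounded independently of each other, so the admissible
  exponents \<open>(k,l)\<close> form a product set. This is what lets a bound at one pole be combined
  with a bound at the other.\<close>
lemma clears_rectangle:
  assumes "bounded_above b" "clears k l b" "clears k' l' b"
  shows "clears k l' b"
proof -
  have "clears (k + int i) l' b \<Longrightarrow> clears k l' b" for i
  proof (induction i)
    case (Suc i)
    have "clears (k + int i) l b"
      using clears_mono_left[OF assms(1,2)] by simp
    then show ?case
      using Suc clears_rectangle_step[OF assms(1)] by (simp add: ac_simps)
  qed simp
  moreover have "clears (k + int (nat (k' - k))) l' b"
    by (rule clears_mono_left[OF assms(1,3)]) simp
  ultimately show ?thesis by blast
qed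

section \<open>Re-expansion around -1 and around 0\<close>

text \<open>After the substitution \<open>y = x - 1\<close> the pole at \<open>y = -1\<close> sits at \<open>x = 0\<close>. The vanishing of the
  coefficients below \<open>x\<^sup>-\<^sup>k\<close> gives the residues of \<open>(y+1)\<^sup>p b(y)\<close> for all \<open>p \<ge> k\<close>; Pascal's rule, applied
  repeatedly, then reaches every negative coefficient of \<open>(y+1)\<^sup>k b(y)\<close>.\<close>
lemma subst_vanishing_below_iff_clears:
  assumes "bounded_above b"
  shows "(\<forall>j< - k. series_subst scale (- 1) b j = 0) \<longleftrightarrow> clears k 0 b"
proof
  assume *: "clears k 0 b"
  show "\<forall>j< - k. series_subst scale (- 1) b j = 0"
  proof (intro allI impI)
    fix j assume "j < - k"
    then have "clears (- j - 1) 0 b"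
      by (intro clears_mono_left[OF assms *]) simp
    then show "series_subst scale (- 1) b j = 0"
      unfolding clears_def series_subst_minus_1 by simp
  qed
next
  assume *: "\<forall>j< - k. series_subst scale (- 1) b j = 0"
  have "\<forall>p\<ge>k. binom_shift scale 1 p b (- p - 1 - int i) = 0" for i
  proof (induction i)
    case 0
    show ?case
    proof (intro allI impI)
      fix p assume "k \<le> p"
      then show "binom_shift scale 1 p b (- p - 1 - int 0) = 0"
        using *[rule_format, of "- p - 1"] by (simp add: series_subst_minus_1)
    qed
  next
    case (Suc i)
    show ?case
    proof (intro allI impI)
      fix p assume "k \<le> p"
      then have "binom_shift scale 1 p b (- p - 1 - int i) = 0"
        "binom_shift scale 1 (p + 1) b (- (p + 1) - 1 - int i) = 0"
        using Suc.IH[rule_format, of p] Suc.IH[rule_format, of "p + 1"] by simp_all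
      then show "binom_shift scale 1 p b (- p - 1 - int (Suc i)) = 0"
        using binom_shift_pascal[OF assms, of 1 p "- p - 1 - int (Suc i)"]
        by (simp add: diff_diff_eq ac_simps)
    qed
  qed
  then have "binom_shift scale 1 k b (- k - 1 - int (nat (- k - 1 - j))) = 0" for j
    by blast
  moreover have "- k - 1 - int (nat (- k - 1 - j)) = j" if "j < - k" for j
    using that by simp
  ultimately have "binom_shift scale 1 k b j = 0" if "j < - k" for j
    using that by metis
  then show "clears k 0 b" unfolding clears_def by simp
qed

lemma subst_bounded_above:
  assumes "bounded_above b"
  shows "bounded_above (series_subst scale (- 1) b)"
proof -
  obtain J where J: "\<And>j. j \<ge> J \<Longrightarrow> b j = 0" using assms unfolding bounded_above_def by blast
  have "series_subst scale (- 1) b j = 0" if "j \<ge> J" for j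
    unfolding series_subst_minus_1 binom_shift_def using J that by simp
  then show ?thesis by (rule bounded_aboveI)
qed

text \<open>The substitution \<open>y = x - 1\<close> turns multiplication by \<open>y\<^sup>l\<close> into multiplication by \<open>(x-1)\<^sup>l\<close>. Each
  factor \<open>x - 1\<close> is one application of Pascal's rule on either side.\<close>
lemma x_minus_1_pow_mult_subst:
  assumes "bounded_above b"
  shows "series_mult scale (x_plus_pow (- 1) (int l)) (series_subst scale (- 1) b) j
       = series_subst scale (- 1) (\<lambda>i. b (i - int l)) j"
proof (induction l arbitrary: j)
  case 0
  then show ?case by (simp add: series_mult_x_plus_pow)
next
  case (Suc l)
  let ?S = "series_subst scale (- 1) b" and ?c = "\<lambda>i. b (i - int l)"
  have c: "bounded_above ?c" using bounded_above_shift[OF assms, of "- int l"] by simp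
  have "series_mult scale (x_plus_pow (- 1) (int (Suc l))) ?S j
      = binom_shift scale (- 1) (int l + 1) ?S (j - 1 - int l)"
    by (simp add: series_mult_x_plus_pow algebra_simps)
  also have "\<dots> = series_mult scale (x_plus_pow (- 1) (int l)) ?S (j - 1)
      - series_mult scale (x_plus_pow (- 1) (int l)) ?S j"
    unfolding binom_shift_pascal[OF subst_bounded_above[OF assms]] series_mult_x_plus_pow
    by (simp add: algebra_simps)
  also have "\<dots> = series_subst scale (- 1) ?c (j - 1) - series_subst scale (- 1) ?c j"
    by (simp only: Suc.IH)
  also have "\<dots> = binom_shift scale 1 (- j - 1) ?c (j - 1)"
    using binom_shift_pascal[OF c, of 1 "- j - 1" "j - 1"] by (simp add: series_subst_minus_1)
  also have "\<dots> = series_subst scale (- 1) (\<lambda>i. b (i - int (Suc l))) j"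
    using binom_shift_translate[of 1 "- j - 1" ?c "- 1" j]
    by (simp add: series_subst_minus_1 algebra_simps)
  finally show ?case .
qed

text \<open>The series on the left is the expansion of \<open>b\<close> around \<open>-1\<close>, as it occurs in \<open>Y\<^sup>L\<close>. The substitution
  turns \<open>y\<^sup>l b(y)\<close> into a series bounded below, and the remaining factor \<open>(-1+x)\<^sup>-\<^sup>l\<close> is a unit in
  \<open>\<complex>[[x]]\<close>, so the lowest exponent is governed by the pole of \<open>b\<close> at \<open>-1\<close> alone.\<close>
lemma left_expansion_vanishing_iff_clears:
  assumes b: "bounded_above b" and cl: "clears k (int l) b"
  shows "(\<forall>j< - N. series_mult scale (plus_x_pow (- 1) (- int l))
            (series_mult scale (x_plus_pow (- 1) (int l)) (series_subst scale (- 1) b)) j = 0)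
         \<longleftrightarrow> clears N (int l) b"
proof -
  let ?b = "\<lambda>i. b (i - int l)"
  have b': "bounded_above ?b" using bounded_above_shift[OF b, of "- int l"] by simp
  have shift: "clears p 0 ?b \<longleftrightarrow> clears p (int l) b" for p
  proof -
    have "clears p 0 ?b \<longleftrightarrow> (\<forall>j< - p. binom_shift scale 1 p b (j - int l) = 0)"
      using binom_shift_translate[of 1 p b "- int l"] by (simp add: clears_def)
    also have "\<dots> \<longleftrightarrow> clears p (int l) b" (is "?A \<longleftrightarrow> _")
    proof
      assume A: ?A
      show "clears p (int l) b"
        unfolding clears_def
      proof (intro allI impI)
        fix j assume "j < - int l - p"
        then show "binom_shift scale 1 p b j = 0" using A[rule_format, of "j + int l"] by simp
      qed
    qed (simp add: clears_def)
    finally show ?thesis .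
  qed
  have eq: "series_mult scale (x_plus_pow (- 1) (int l)) (series_subst scale (- 1) b)
      = series_subst scale (- 1) ?b"
    using x_minus_1_pow_mult_subst[OF b] by blast
  have "\<forall>j< - k. series_subst scale (- 1) ?b j = 0"
    using subst_vanishing_below_iff_clears[OF b'] shift cl by blast
  then have "(\<forall>j< - N. series_mult scale (plus_x_pow (- 1) (- int l))
            (series_subst scale (- 1) ?b) j = 0)
      \<longleftrightarrow> (\<forall>j< - N. series_subst scale (- 1) ?b j = 0)"
    by (intro plus_x_pow_vanishing_below[where ?J0.0 = "- k"]) simp_all
  also have "\<dots> \<longleftrightarrow> clears N (int l) b"
    using subst_vanishing_below_iff_clears[OF b'] shift by blast
  finally show ?thesis unfolding eq .
qed

text \<open>The series on the left is the expansion of \<open>b\<close> around \<open>0\<close>, as it occurs in \<open>Y\<^sup>R\<close>. The hypothesis makes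
  \<open>(x+1)\<^sup>k b(x)\<close> bounded below, and \<open>(1+x)\<^sup>-\<^sup>k\<close> is a unit in \<open>\<complex>[[x]]\<close>.\<close>
lemma right_expansion_vanishing_iff_clears:
  assumes cl: "clears k l b"
  shows "(\<forall>j< - N. series_mult scale (plus_x_pow 1 (- k))
            (series_mult scale (x_plus_pow 1 k) b) j = 0)
         \<longleftrightarrow> clears k N b"
proof -
  have eq: "clears k p b \<longleftrightarrow> (\<forall>j< - p. series_mult scale (x_plus_pow 1 k) b j = 0)" for p
  proof
    assume A: "\<forall>j< - p. series_mult scale (x_plus_pow 1 k) b j = 0"
    show "clears k p b"
      unfolding clears_def
    proof (intro allI impI)
      fix j assume "j < - p - k"
      then show "binom_shift scale 1 k b j = 0"
        using A[rule_format, of "j + k"] by (simp add: series_mult_x_plus_pow)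
    qed
  qed (simp add: clears_def series_mult_x_plus_pow)
  show ?thesis
    unfolding eq
    by (rule plus_x_pow_vanishing_below[where ?J0.0 = "- l"]) (use cl eq in auto)
qed

end

lemma linear_binom_shift:
  assumes f: "Vector_Spaces.linear s s' f" and b: "bounded_above b"
  shows "f (binom_shift s c a b m) = binom_shift s' c a (f \<circ> b) m"
proof -
  interpret f: Vector_Spaces.linear s s' f by fact
  interpret S: complex_space s by unfold_locales
  interpret S': complex_space s' by unfold_locales
  obtain K where K: "\<And>t. t \<ge> K \<Longrightarrow> b (m + int t) = 0"
    using S.bounded_above_from[OF b, of m] by metis
  then have fK: "\<And>t. t \<ge> K \<Longrightarrow> (f \<circ> b) (m + int t) = 0" by (simp add: f.zero)
  have "binom_shift s c a b m = (\<Sum>t<K. s ((of_int a gchoose t) * c ^ t) (b (m + int t)))"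
    by (rule S.binom_shift_eq_sum) (rule K)
  moreover have "binom_shift s' c a (f \<circ> b) m
      = (\<Sum>t<K. s' ((of_int a gchoose t) * c ^ t) ((f \<circ> b) (m + int t)))"
    by (rule S'.binom_shift_eq_sum) (rule fK)
  ultimately show ?thesis
    by (simp add: f.sum f.scale)
qed

section \<open>The grading of a vertex operator algebra\<close>

locale voa =
  fixes V :: "'v::ab_group_add voa"
  assumes voa: "vertex_operator_algebra V"
begin

sublocale complex_space "scl V"
  using voa by (simp add: vertex_operator_algebra_def complex_space_def)

lemma linear_Lop: "Vector_Spaces.linear (scl V) (scl V) (Lop V V m)"
  using voa by (simp add: vertex_operator_algebra_def weak_module_def Lop_def)

sublocale L: Vector_Spaces.linear "scl V" "scl V" "Lop V V m" for m
  by (rule linear_Lop)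

text \<open>This is the Virasoro relation \<open>[L(m), L(0)] = m L(m)\<close>; the central term is absent because
  \<open>m \<noteq> 0\<close>.\<close>
lemma Lop_weight_space:
  assumes "m \<noteq> 0" "v \<in> weight_space V h"
  shows "Lop V V m v \<in> weight_space V (h - m)"
proof -
  have "Lop V V m (Lop V V 0 v) - Lop V V 0 (Lop V V m v) = scl V (of_int m) (Lop V V m v)"
    using voa assms(1) by (auto simp: vertex_operator_algebra_def)
  moreover have "Lop V V m (Lop V V 0 v) = scl V (of_int h) (Lop V V m v)"
    using assms(2) by (simp add: weight_space_def L.scale)
  ultimately have "Lop V V 0 (Lop V V m v)
      = scl V (of_int h) (Lop V V m v) - scl V (of_int m) (Lop V V m v)"
    by (simp add: algebra_simps)
  then show ?thesis by (simp add: weight_space_def scale_left_diff_distrib)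
qed

lemma weight_space_L1_power:
  assumes "v \<in> weight_space V h"
  shows "(Lop V V 1 ^^ i) v \<in> weight_space V (h - int i)"
proof (induction i)
  case (Suc i)
  then show ?case using Lop_weight_space[of 1, OF _ Suc] by (simp add: algebra_simps)
qed (use assms in simp)

lemma weight_bounded_below:
  obtains N where "\<And>h v. h < N \<Longrightarrow> v \<in> weight_space V h \<Longrightarrow> v = 0"
  using voa unfolding vertex_operator_algebra_def by blast

lemma L1_nilpotent:
  assumes "v \<in> weight_space V h"
  obtains M where "\<And>i. i \<ge> M \<Longrightarrow> (Lop V V 1 ^^ i) v = 0"
proof -
  obtain N where N: "\<And>h v. h < N \<Longrightarrow> v \<in> weight_space V h \<Longrightarrow> v = 0"
    using weight_bounded_below by blast
  have "(Lop V V 1 ^^ i) v = 0" if "i \<ge> Suc (nat (h - N))" for i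
    by (rule N[OF _ weight_space_L1_power[OF assms]]) (use that in linarith)
  then show ?thesis by (rule that)
qed

lemma zero_in_weight_space: "0 \<in> weight_space V h"
  by (simp add: weight_space_def L.zero)

lemma weight_space_add:
  "u \<in> weight_space V h \<Longrightarrow> v \<in> weight_space V h \<Longrightarrow> u + v \<in> weight_space V h"
  by (simp add: weight_space_def L.add scale_right_distrib)

lemma weight_space_scale: "v \<in> weight_space V h \<Longrightarrow> scl V c v \<in> weight_space V h"
  by (simp add: weight_space_def L.scale mult.commute)

text \<open>Eigenvectors of \<open>L(0)\<close> for distinct eigenvalues: subtracting \<open>k\<close> times the relation from its image
  under \<open>L(0)\<close> removes the summand of weight \<open>k\<close>.\<close>
lemma weight_spaces_independent:
  assumes "finite S" "\<And>h. h \<in> S \<Longrightarrow> d h \<in> weight_space V h" "(\<Sum>h\<in>S. d h) = 0" "h \<in> S"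
  shows "d h = 0"
  using assms
proof (induction S arbitrary: d h rule: finite_induct)
  case (insert k S)
  have "0 = Lop V V 0 (\<Sum>h\<in>insert k S. d h) - scl V (of_int k) (\<Sum>h\<in>insert k S. d h)"
    using insert.prems by (simp add: L.zero)
  also have "\<dots> = (\<Sum>h\<in>insert k S. scl V (of_int h) (d h)) - (\<Sum>h\<in>insert k S. scl V (of_int k) (d h))"
    unfolding L.sum scale_sum_right
    using insert.prems(1) by (intro arg_cong2[where f = "(-)"] sum.cong) (auto simp: weight_space_def)
  also have "\<dots> = (\<Sum>h\<in>S. scl V (of_int (h - k)) (d h))"
    using insert.hyps by (simp add: sum_subtractf scale_left_diff_distrib)
  finally have zero: "(\<Sum>h\<in>S. scl V (of_int (h - k)) (d h)) = 0" by simp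
  have S: "d i = 0" if "i \<in> S" for i
  proof -
    have "scl V (of_int (i - k)) (d i) = 0"
    proof (rule insert.IH)
      fix h assume "h \<in> S"
      then show "scl V (of_int (h - k)) (d h) \<in> weight_space V h"
        using insert.prems(1) weight_space_scale by blast
    qed (fact zero, fact that)
    moreover have "i \<noteq> k" using that insert.hyps by blast
    ultimately show ?thesis by (simp add: scale_eq_0_iff)
  qed
  then have "d k = 0" using insert.prems(2) insert.hyps by simp
  with S insert.prems(3) show ?case by auto
qed simp

text \<open>Phrased exactly as under the description operator in \<^const>\<open>weight_component\<close>, so that uniqueness
  evaluates that operator.\<close>
definition homogeneous_decomposition :: "(int \<Rightarrow> 'v) \<Rightarrow> 'v \<Rightarrow> bool" where
  "homogeneous_decomposition c v \<longleftrightarrow>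
     (\<forall>k. c k \<in> weight_space V k) \<and> finite {k. c k \<noteq> 0} \<and> v = Sum_any c"

lemma homogeneous_decomposition_unique:
  assumes "homogeneous_decomposition c v" "homogeneous_decomposition c' v"
  shows "c = c'"
proof
  fix k
  let ?S = "insert k ({k. c k \<noteq> 0} \<union> {k. c' k \<noteq> 0})"
  have S: "finite ?S" using assms by (simp add: homogeneous_decomposition_def)
  have "v = sum c ?S" "v = sum c' ?S"
    using assms Sum_any.expand_superset[OF S, of c] Sum_any.expand_superset[OF S, of c']
    unfolding homogeneous_decomposition_def by auto
  then have "(\<Sum>h\<in>?S. c h + scl V (- 1) (c' h)) = 0"
    by (simp only: sum.distrib scale_sum_right[symmetric]) simp
  moreover have "c h + scl V (- 1) (c' h) \<in> weight_space V h" for h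
    using assms unfolding homogeneous_decomposition_def
    by (intro weight_space_add weight_space_scale) auto
  ultimately have "c k + scl V (- 1) (c' k) = 0"
    using weight_spaces_independent[OF S, of "\<lambda>h. c h + scl V (- 1) (c' h)" k] by blast
  then show "c k = c' k" by simp
qed

lemma weight_component_eq:
  assumes "homogeneous_decomposition c v"
  shows "weight_component V h v = c h"
proof -
  have "(THE c. homogeneous_decomposition c v) = c"
    using assms homogeneous_decomposition_unique by blast
  then show ?thesis
    unfolding weight_component_def homogeneous_decomposition_def[symmetric] by simp
qed

lemma homogeneous_decomposition_single:
  assumes "v \<in> weight_space V h"
  shows "homogeneous_decomposition (\<lambda>k. if k = h then v else 0) v"
  unfolding homogeneous_decomposition_def
  using assms zero_in_weight_space by (auto intro: finite_subset[of _ "{h}"])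

lemma homogeneous_decomposition_exists: "\<exists>c. homogeneous_decomposition c v"
proof -
  have "v \<in> span (\<Union>h. weight_space V h)"
    using voa by (simp add: vertex_operator_algebra_def)
  then show ?thesis
  proof (induction rule: span_induct_alt)
    case base
    show ?case using homogeneous_decomposition_single[OF zero_in_weight_space] by blast
  next
    case (step a u v)
    then obtain h c where u: "u \<in> weight_space V h" and c: "homogeneous_decomposition c v" by blast
    let ?c = "\<lambda>k. (if k = h then scl V a u else 0) + c k"
    have fin: "finite {k. (if k = h then scl V a u else 0) \<noteq> 0}" "finite {k. c k \<noteq> 0}"
      using c by (auto intro: finite_subset[of _ "{h}"] simp: homogeneous_decomposition_def)
    have "{k. ?c k \<noteq> 0} \<subseteq> {k. (if k = h then scl V a u else 0) \<noteq> 0} \<union> {k. c k \<noteq> 0}" by auto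
    then have "finite {k. ?c k \<noteq> 0}" using fin finite_subset by blast
    moreover have "Sum_any ?c = scl V a u + v"
      using Sum_any.distrib[OF fin] c by (simp add: homogeneous_decomposition_def)
    moreover have "?c k \<in> weight_space V k" for k
      using c u unfolding homogeneous_decomposition_def
      by (intro weight_space_add) (auto intro: weight_space_scale zero_in_weight_space)
    ultimately have "homogeneous_decomposition ?c (scl V a u + v)"
      unfolding homogeneous_decomposition_def by simp
    then show ?case by blast
  qed
qed

lemma opp_vec_homogeneous:
  assumes "v \<in> weight_space V h"
  shows "opp_vec V v j = (if 0 \<le> j + 2 * h
     then scl V ((- 1) powi h / fact (nat (j + 2 * h))) ((Lop V V 1 ^^ nat (j + 2 * h)) v) else 0)"
proof -
  have "(Lop V V 1 ^^ i) 0 = 0" for i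
    by (induction i) (simp_all add: L.zero)
  then have "opp_vec V v j = Sum_any (\<lambda>k. if k = h then (if 0 \<le> j + 2 * h
     then scl V ((- 1) powi h / fact (nat (j + 2 * h))) ((Lop V V 1 ^^ nat (j + 2 * h)) v) else 0) else 0)"
    unfolding opp_vec_def weight_component_eq[OF homogeneous_decomposition_single[OF assms]]
    by (intro Sum_any.cong) auto
  then show ?thesis by simp
qed

lemma opp_vec_decomposition:
  assumes "homogeneous_decomposition c v"
  shows "opp_vec V v j = (\<Sum>h | c h \<noteq> 0. opp_vec V (c h) j)"
proof -
  have hom: "c h \<in> weight_space V h" for h
    using assms by (simp add: homogeneous_decomposition_def)
  have L0: "(Lop V V 1 ^^ i) 0 = 0" for i
    by (induction i) (simp_all add: L.zero)
  have "opp_vec V v j = Sum_any (\<lambda>h. opp_vec V (c h) j)"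
    unfolding opp_vec_homogeneous[OF hom] unfolding opp_vec_def weight_component_eq[OF assms] ..
  also have "\<dots> = (\<Sum>h | c h \<noteq> 0. opp_vec V (c h) j)"
  proof (rule Sum_any.expand_superset)
    have "opp_vec V 0 j = 0"
      by (simp add: opp_vec_homogeneous[OF zero_in_weight_space[of 0]] L0)
    then show "{h. opp_vec V (c h) j \<noteq> 0} \<subseteq> {h. c h \<noteq> 0}" by auto
  qed (use assms in \<open>simp add: homogeneous_decomposition_def\<close>)
  finally show ?thesis .
qed

lemma finite_support_opp_vec:
  assumes "v \<in> weight_space V h"
  shows "finite {j. opp_vec V v j \<noteq> 0}"
proof -
  obtain M where M: "\<And>i. i \<ge> M \<Longrightarrow> (Lop V V 1 ^^ i) v = 0" using L1_nilpotent[OF assms] by blast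
  have "opp_vec V v j = 0" if "j \<notin> {- 2 * h..<- 2 * h + int M}" for j
    unfolding opp_vec_homogeneous[OF assms] using that by (auto simp: M)
  then have "{j. opp_vec V v j \<noteq> 0} \<subseteq> {- 2 * h..<- 2 * h + int M}" by blast
  then show ?thesis by (rule finite_subset) simp
qed

end

section \<open>The opposite field on a weak module\<close>

locale voa_module = voa V for V :: "'v::ab_group_add voa" +
  fixes W :: "('v, 'w::ab_group_add) vmodule"
  assumes weak_module: "weak_module V W"
begin

sublocale W: complex_space "scl W"
  using weak_module by (simp add: weak_module_def complex_space_def)

sublocale act_left: Vector_Spaces.linear "scl V" "scl W" "\<lambda>v. act W v m w" for m w
  using weak_module by (simp add: weak_module_def)

lemma bounded_above_act: "bounded_above (\<lambda>m. act W v m w)"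
  using weak_module by (simp add: weak_module_def bounded_above_def)

lemma act_derivative:
  "act W (Lop V V (- 1) v) m w = scl W (- of_int m) (act W v (m - 1) w)"
  using weak_module by (simp add: weak_module_def)

text \<open>The formula \<open>Y\<^sup>o(v,x) = \<Sum>i. (-1)\<^sup>h/i! x\<^sup>i\<^sup>-\<^sup>2\<^sup>h Y(L(1)\<^sup>i v, x\<^sup>-\<^sup>1)\<close> for \<open>v\<close> of weight \<open>h\<close>, read
  coefficientwise.\<close>
lemma Yo_homogeneous:
  assumes v: "v \<in> weight_space V h" and M: "\<And>i. i \<ge> M \<Longrightarrow> (Lop V V 1 ^^ i) v = 0"
  shows "Yo V W v w k = (\<Sum>i<M. scl W ((- 1) powi h / fact i)
           (act W ((Lop V V 1 ^^ i) v) (k + (2 * h - 1 - int i)) w))"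
proof -
  have "Yo V W v w k = Sum_any (\<lambda>i::nat. act W (opp_vec V v (int i - 2 * h)) (k - (int i - 2 * h) - 1) w)"
    unfolding Yo_def
  proof (rule Sum_any_reindex_range)
    fix j assume j: "j \<notin> range (\<lambda>i. int i - 2 * h)"
    have "\<not> 0 \<le> j + 2 * h"
    proof
      assume "0 \<le> j + 2 * h"
      then have "j = int (nat (j + 2 * h)) - 2 * h" by simp
      then show False using j by blast
    qed
    then show "act W (opp_vec V v j) (k - j - 1) w = 0"
      by (simp add: opp_vec_homogeneous[OF v] act_left.zero)
  qed (auto simp: inj_def)
  also have "\<dots> = Sum_any (\<lambda>i::nat. scl W ((- 1) powi h / fact i)
           (act W ((Lop V V 1 ^^ i) v) (k + (2 * h - 1 - int i)) w))"
    by (simp add: opp_vec_homogeneous[OF v] act_left.scale algebra_simps)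
  also have "\<dots> = (\<Sum>i<M. scl W ((- 1) powi h / fact i)
           (act W ((Lop V V 1 ^^ i) v) (k + (2 * h - 1 - int i)) w))"
    by (rule Sum_any_eq_sum_lessThan) (simp add: M act_left.zero)
  finally show ?thesis .
qed

lemma Yo_decomposition:
  assumes "homogeneous_decomposition c v"
  shows "Yo V W v w k = (\<Sum>h | c h \<noteq> 0. Yo V W (c h) w k)"
proof -
  let ?S = "{h. c h \<noteq> 0}"
  have fin: "finite ?S" and hom: "\<And>h. c h \<in> weight_space V h"
    using assms by (simp_all add: homogeneous_decomposition_def)
  define J where "J = (\<Union>h\<in>?S. {j. opp_vec V (c h) j \<noteq> 0})"
  have J: "finite J" unfolding J_def using fin finite_support_opp_vec[OF hom] by blast
  have outside: "opp_vec V (c h) j = 0" if "h \<in> ?S" "j \<notin> J" for h j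
    using that unfolding J_def by blast
  have "Yo V W v w k = (\<Sum>j\<in>J. act W (opp_vec V v j) (k - j - 1) w)"
    unfolding Yo_def
  proof (rule Sum_any.expand_superset[OF J])
    have "act W (opp_vec V v j) (k - j - 1) w = 0" if "j \<notin> J" for j
      unfolding opp_vec_decomposition[OF assms] using outside[OF _ that] by (simp add: act_left.zero)
    then show "{j. act W (opp_vec V v j) (k - j - 1) w \<noteq> 0} \<subseteq> J" by blast
  qed
  also have "\<dots> = (\<Sum>h\<in>?S. \<Sum>j\<in>J. act W (opp_vec V (c h) j) (k - j - 1) w)"
    unfolding opp_vec_decomposition[OF assms] act_left.sum by (rule sum.swap)
  also have "\<dots> = (\<Sum>h\<in>?S. Yo V W (c h) w k)"
  proof (rule sum.cong)
    fix h assume h: "h \<in> ?S"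
    have "act W (opp_vec V (c h) j) (k - j - 1) w = 0" if "j \<notin> J" for j
      using outside[OF h that] by (simp add: act_left.zero)
    then have "{j. act W (opp_vec V (c h) j) (k - j - 1) w \<noteq> 0} \<subseteq> J" by blast
    then show "(\<Sum>j\<in>J. act W (opp_vec V (c h) j) (k - j - 1) w) = Yo V W (c h) w k"
      unfolding Yo_def by (rule Sum_any.expand_superset[OF J, symmetric])
  qed simp
  finally show ?thesis .
qed

lemma bounded_above_Yo: "bounded_above (Yo V W v w)"
proof -
  obtain c where c: "homogeneous_decomposition c v" using homogeneous_decomposition_exists by blast
  have hom: "bounded_above (Yo V W (c h) w)" for h
  proof -
    have h: "c h \<in> weight_space V h" using c by (simp add: homogeneous_decomposition_def)
    obtain M where M: "\<And>i. i \<ge> M \<Longrightarrow> (Lop V V 1 ^^ i) (c h) = 0" using L1_nilpotent[OF h] by blast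
    have "bounded_above (\<lambda>k. \<Sum>i<M. scl W ((- 1) powi h / fact i)
           (act W ((Lop V V 1 ^^ i) (c h)) (k + (2 * h - 1 - int i)) w))"
    proof (rule bounded_above_sum)
      fix i
      show "bounded_above (\<lambda>k. scl W ((- 1) powi h / fact i)
           (act W ((Lop V V 1 ^^ i) (c h)) (k + (2 * h - 1 - int i)) w))"
        using bounded_above_shift[OF bounded_above_act[of "(Lop V V 1 ^^ i) (c h)" w], of "2 * h - 1 - int i"]
        unfolding bounded_above_def by auto
    qed simp
    moreover have "Yo V W (c h) w = (\<lambda>k. \<Sum>i<M. scl W ((- 1) powi h / fact i)
           (act W ((Lop V V 1 ^^ i) (c h)) (k + (2 * h - 1 - int i)) w))"
      by (rule ext, rule Yo_homogeneous[OF h]) (rule M)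
    ultimately show ?thesis by simp
  qed
  have "bounded_above (\<lambda>k. \<Sum>h | c h \<noteq> 0. Yo V W (c h) w k)"
    using c hom by (intro bounded_above_sum) (simp_all add: homogeneous_decomposition_def)
  then show ?thesis unfolding Yo_decomposition[OF c, symmetric] .
qed

lemma O'_eq_span:
  "O' V W n = W.span {binom_shift (scl W) 1 (h + int n) (\<lambda>m. act W v m w) (- 2 * int n - 2)
                      | h v w. v \<in> weight_space V h}"
proof -
  have "Res (series_mult (scl W) (x_pow (- 2 * int n - 2))
          (series_mult (scl W) (plus_x_pow 1 (h + int n)) (field_series W v w)))
      = binom_shift (scl W) 1 (h + int n) (\<lambda>m. act W v m w) (- 2 * int n - 2)" for h v w
  proof -
    have "Res (series_mult (scl W) (x_pow (- 2 * int n - 2))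
          (series_mult (scl W) (plus_x_pow 1 (h + int n)) (field_series W v w)))
        = binom_shift (scl W) 1 (h + int n) (\<lambda>m. act W v (m + - 1) w) (- 1 - 2 * int n)"
      by (simp add: Res_def W.series_mult_x_pow W.series_mult_plus_1_x_pow field_series_def)
    also have "\<dots> = binom_shift (scl W) 1 (h + int n) (\<lambda>m. act W v m w) (- 1 - 2 * int n + - 1)"
      by (rule W.binom_shift_translate)
    also have "- 1 - 2 * int n + - 1 = - 2 * int n - 2" by simp
    finally show ?thesis .
  qed
  then show ?thesis unfolding O'_def by simp
qed

end

section \<open>Linear maps vanishing on O'\<close>

text \<open>The map \<open>f\<close> is fixed from here on: both equalities of the theorem compare conditions on one
  linear map.\<close>
locale hom_from_module = voa_module V W
  for V :: "'v::ab_group_add voa" and W :: "('v, 'w::ab_group_add) vmodule" +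
  fixes sU :: "complex \<Rightarrow> 'u \<Rightarrow> 'u::ab_group_add" and f :: "'w \<Rightarrow> 'u"
  assumes linear: "Vector_Spaces.linear (scl W) sU f"
begin

sublocale f: Vector_Spaces.linear "scl W" sU f
  by (rule linear)

sublocale U: complex_space sU
  by unfold_locales

definition matrix_coeff :: "'v \<Rightarrow> 'w \<Rightarrow> int \<Rightarrow> 'u" where
  "matrix_coeff v w m = f (act W v m w)"

text \<open>\<open>Res\<^sub>x x\<^sup>m (1+x)\<^sup>h\<^sup>+\<^sup>n f Y(v,x)w = 0\<close> for all \<open>m \<le> -2n-2\<close>, where \<open>h\<close> stands for the weight of \<open>v\<close>.\<close>
definition vanishes_on_modes :: "nat \<Rightarrow> int \<Rightarrow> 'v \<Rightarrow> bool" where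
  "vanishes_on_modes n h v \<longleftrightarrow>
     (\<forall>w. \<forall>m \<le> - 2 * int n - 2. binom_shift sU 1 (h + int n) (matrix_coeff v w) m = 0)"

lemma bounded_above_comp: "bounded_above b \<Longrightarrow> bounded_above (f \<circ> b)"
  unfolding bounded_above_def by (metis comp_apply f.zero)

lemma matrix_coeff_eq_comp: "matrix_coeff v w = f \<circ> (\<lambda>m. act W v m w)"
  by (simp add: matrix_coeff_def fun_eq_iff)

lemma bounded_above_matrix_coeff: "bounded_above (matrix_coeff v w)"
  unfolding matrix_coeff_eq_comp by (rule bounded_above_comp[OF bounded_above_act])

lemma vanishes_on_O'_iff:
  "(\<forall>w\<in>O' V W n. f w = 0)
   \<longleftrightarrow> (\<forall>h. \<forall>v\<in>weight_space V h. \<forall>w.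
         binom_shift sU 1 (h + int n) (matrix_coeff v w) (- 2 * int n - 2) = 0)"
proof -
  have f_gen: "f (binom_shift (scl W) 1 a (\<lambda>m. act W v m w) m)
      = binom_shift sU 1 a (matrix_coeff v w) m" for a v w m
    unfolding matrix_coeff_eq_comp by (rule linear_binom_shift[OF linear bounded_above_act])
  let ?g = "\<lambda>h v w. binom_shift (scl W) 1 (h + int n) (\<lambda>m. act W v m w) (- 2 * int n - 2)"
  have span: "(\<forall>w\<in>W.span S. f w = 0) \<longleftrightarrow> (\<forall>w\<in>S. f w = 0)" for S
    using f.eq_0_on_span[of S] W.span_base[of _ S] by blast
  have "(\<forall>w\<in>O' V W n. f w = 0) \<longleftrightarrow> (\<forall>u\<in>{?g h v w | h v w. v \<in> weight_space V h}. f u = 0)"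
    unfolding O'_eq_span by (rule span)
  also have "\<dots> \<longleftrightarrow> (\<forall>h. \<forall>v\<in>weight_space V h. \<forall>w. f (?g h v w) = 0)"
    by (simp only: mem_Collect_eq Ball_def) blast
  finally show ?thesis unfolding f_gen .
qed

text \<open>Only \<open>m = -2n-2\<close> occurs in \<open>O'\<^sub>n(W)\<close>. The step from \<open>m\<close> to \<open>m - 1\<close> applies the residue at \<open>m\<close> to
  \<open>L(-1)v\<close>, which has weight \<open>h + 1\<close>, and integrates by parts.\<close>
lemma vanishes_on_O'_iff_vanishes_on_modes:
  "(\<forall>w\<in>O' V W n. f w = 0) \<longleftrightarrow> (\<forall>h. \<forall>v\<in>weight_space V h. vanishes_on_modes n h v)"
proof
  assume "\<forall>h. \<forall>v\<in>weight_space V h. vanishes_on_modes n h v"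
  then show "\<forall>w\<in>O' V W n. f w = 0"
    unfolding vanishes_on_O'_iff vanishes_on_modes_def by simp
next
  assume "\<forall>w\<in>O' V W n. f w = 0"
  then have base: "binom_shift sU 1 (h + int n) (matrix_coeff v w) (- 2 * int n - 2) = 0"
    if "v \<in> weight_space V h" for h v w
    using that unfolding vanishes_on_O'_iff by blast
  have all: "binom_shift sU 1 (h + int n) (matrix_coeff v w) (- 2 * int n - 2 - int i) = 0"
    if "v \<in> weight_space V h" for h v w i
    using that
  proof (induction i arbitrary: h v)
    case 0
    then show ?case using base by simp
  next
    case (Suc i)
    let ?b = "matrix_coeff v w" and ?m = "- 2 * int n - 2 - int i" and ?a = "h + int n"
    have "Lop V V (- 1) v \<in> weight_space V (h + 1)"
      using Lop_weight_space[of "- 1", OF _ Suc.prems] by simp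
    then have "binom_shift sU 1 (h + 1 + int n) (matrix_coeff (Lop V V (- 1) v) w) ?m = 0"
      by (rule Suc.IH)
    moreover have "matrix_coeff (Lop V V (- 1) v) w = (\<lambda>j. sU (- of_int j) (?b (j - 1)))"
      unfolding matrix_coeff_def act_derivative f.scale ..
    moreover have "h + 1 + int n = ?a + 1" by simp
    ultimately have "binom_shift sU 1 (?a + 1) (\<lambda>j. sU (- of_int j) (?b (j - 1))) ?m = 0"
      by simp
    moreover have m: "binom_shift sU 1 ?a ?b ?m = 0" by (rule Suc.IH[OF Suc.prems])
    ultimately have "sU (of_int ?m) (binom_shift sU 1 (?a + 1) ?b (?m - 1)) = 0"
      unfolding U.binom_shift_derivative[OF bounded_above_matrix_coeff] by simp
    (* ?m \<le> -2, so integration by parts determines the residue at ?m - 1 *)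
    moreover have "(of_int ?m :: complex) \<noteq> 0" unfolding of_int_eq_0_iff by simp
    ultimately have "binom_shift sU 1 (?a + 1) ?b (?m - 1) = 0"
      unfolding f.vs2.scale_eq_0_iff by blast
    then have "binom_shift sU 1 ?a ?b (?m - 1) = 0"
      using U.binom_shift_pascal[OF bounded_above_matrix_coeff, of 1 ?a v w "?m - 1"] m
      by (metis diff_add_cancel f.vs2.scale_one add_0_right)
    then show ?case by (simp add: diff_diff_eq ac_simps)
  qed
  show "\<forall>h. \<forall>v\<in>weight_space V h. vanishes_on_modes n h v"
    unfolding vanishes_on_modes_def
  proof (intro allI ballI impI)
    fix h v w m assume "v \<in> weight_space V h" and m: "m \<le> - 2 * int n - 2"
    then show "binom_shift sU 1 (h + int n) (matrix_coeff v w) m = 0"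
      using all[of v h w "nat (- 2 * int n - 2 - m)"] by simp
  qed
qed

definition opposite_coeff :: "'v \<Rightarrow> 'w \<Rightarrow> int \<Rightarrow> 'u" where
  "opposite_coeff v w = f \<circ> Yo V W v w"

lemma bounded_above_opposite_coeff: "bounded_above (opposite_coeff v w)"
  unfolding opposite_coeff_def by (rule bounded_above_comp[OF bounded_above_Yo])

lemma clears_poles_iff: "clears_poles V W sU f v k l \<longleftrightarrow> (\<forall>w. U.clears k l (opposite_coeff v w))"
  unfolding clears_poles_def U.clears_iff opposite_coeff_def ..

text \<open>With \<open>y = x\<^sup>-\<^sup>1\<close> one has \<open>(x+1)\<^sup>a = x\<^sup>a (1+y)\<^sup>a\<close>. Up to a translation of indices, multiplication by
  \<open>(x+1)\<^sup>a\<close> in \<open>U((x\<^sup>-\<^sup>1))\<close> is therefore the same operator on coefficients as multiplication by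
  \<open>(1+y)\<^sup>a\<close> in \<open>U((y))\<close>.\<close>
lemma binom_shift_opposite_coeff:
  assumes v: "v \<in> weight_space V h" and M: "\<And>i. i \<ge> M \<Longrightarrow> (Lop V V 1 ^^ i) v = 0"
  shows "binom_shift sU 1 a (opposite_coeff v w) j = (\<Sum>i<M. sU ((- 1) powi h / fact i)
           (binom_shift sU 1 a (matrix_coeff ((Lop V V 1 ^^ i) v) w) (j + (2 * h - 1 - int i))))"
proof -
  have "opposite_coeff v w = (\<lambda>k. \<Sum>i<M. sU ((- 1) powi h / fact i)
           (matrix_coeff ((Lop V V 1 ^^ i) v) w (k + (2 * h - 1 - int i))))"
  proof
    fix k
    have "Yo V W v w k = (\<Sum>i<M. scl W ((- 1) powi h / fact i)
           (act W ((Lop V V 1 ^^ i) v) (k + (2 * h - 1 - int i)) w))"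
      by (rule Yo_homogeneous[OF v]) (rule M)
    then show "opposite_coeff v w k = (\<Sum>i<M. sU ((- 1) powi h / fact i)
           (matrix_coeff ((Lop V V 1 ^^ i) v) w (k + (2 * h - 1 - int i))))"
      by (simp add: opposite_coeff_def matrix_coeff_def f.sum f.scale)
  qed
  then have "binom_shift sU 1 a (opposite_coeff v w) j
      = (\<Sum>i<M. sU ((- 1) powi h / fact i) (binom_shift sU 1 a
           (\<lambda>k. matrix_coeff ((Lop V V 1 ^^ i) v) w (k + (2 * h - 1 - int i))) j))"
    by (simp only:) (intro U.binom_shift_sum bounded_above_shift bounded_above_matrix_coeff finite_lessThan)
  then show ?thesis unfolding U.binom_shift_translate .
qed

text \<open>The coefficient of \<open>x\<^sup>p\<close>, \<open>p < 0\<close>, in \<open>x\<^sup>h\<^sup>+\<^sup>n (x+1)\<^sup>h\<^sup>+\<^sup>n f Y\<^sup>o(v,x)w\<close> combines the residues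
  of \<open>y\<^sup>m\<^sup>-\<^sup>i (1+y)\<^sup>h\<^sup>+\<^sup>n f Y(L(1)\<^sup>i v,y)w\<close> with \<open>m = p - 2n - 1 \<le> -2n-2\<close>. Since \<open>L(1)\<^sup>i v\<close> has weight
  \<open>h - i\<close>, the factor \<open>(1+y)\<^sup>i\<close> is in excess, and it raises the exponent of \<open>y\<close> by at most \<open>i\<close>. The
  combination is triangular with respect to the weight, with diagonal entries \<open>(-1)\<^sup>h\<close>.\<close>
lemma vanishes_on_O'_iff_clears_poles:
  "(\<forall>w\<in>O' V W n. f w = 0)
   \<longleftrightarrow> (\<forall>h. \<forall>v\<in>weight_space V h. clears_poles V W sU f v (h + int n) (h + int n))"
  unfolding vanishes_on_O'_iff_vanishes_on_modes
proof
  assume *: "\<forall>h. \<forall>v\<in>weight_space V h. vanishes_on_modes n h v"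
  show "\<forall>h. \<forall>v\<in>weight_space V h. clears_poles V W sU f v (h + int n) (h + int n)"
    unfolding clears_poles_iff U.clears_def
  proof (intro allI ballI impI)
    fix h v w j
    assume v: "v \<in> weight_space V h" and j: "j < - (h + int n) - (h + int n)"
    obtain M where M: "\<And>i. i \<ge> M \<Longrightarrow> (Lop V V 1 ^^ i) v = 0" using L1_nilpotent[OF v] by blast
    have "binom_shift sU 1 (h + int n) (matrix_coeff ((Lop V V 1 ^^ i) v) w) (j + (2 * h - 1 - int i)) = 0"
      for i
    proof -
      let ?b = "matrix_coeff ((Lop V V 1 ^^ i) v) w"
      have "binom_shift sU 1 (h - int i + int n + int i) ?b (j + (2 * h - 1 - int i)) = 0"
      proof (rule U.binom_shift_vanishing_add[OF bounded_above_matrix_coeff])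
        fix m assume "m \<le> - 2 * int n - 2"
        then show "binom_shift sU 1 (h - int i + int n) ?b m = 0"
          using * weight_space_L1_power[OF v, of i] unfolding vanishes_on_modes_def by blast
      qed (use j in simp)
      then show ?thesis by simp
    qed
    then show "binom_shift sU 1 (h + int n) (opposite_coeff v w) j = 0"
      by (subst binom_shift_opposite_coeff[OF v, where M = M]) (simp_all add: M)
  qed
next
  assume *: "\<forall>h. \<forall>v\<in>weight_space V h. clears_poles V W sU f v (h + int n) (h + int n)"
  obtain N where N: "\<And>h v. h < N \<Longrightarrow> v \<in> weight_space V h \<Longrightarrow> v = 0"
    using weight_bounded_below by blast
  have zero: "vanishes_on_modes n h 0" for h
    by (simp add: vanishes_on_modes_def matrix_coeff_def binom_shift_def act_left.zero f.zero)
  have "vanishes_on_modes n h v" if "v \<in> weight_space V h" for h v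
    using that
    (* The summand 1 keeps the measure positive at the least weight N, where L(1) leads below N. *)
  proof (induction "nat (h + 1 - N)" arbitrary: h v rule: less_induct)
    case less
    show ?case
    proof (cases "h < N")
      case True
      then show ?thesis using N less.prems zero by blast
    next
      case False
      obtain M where M': "\<And>i. i \<ge> M \<Longrightarrow> (Lop V V 1 ^^ i) v = 0"
        using L1_nilpotent[OF less.prems] by blast
      (* a summation bound of the form Suc M, so that the term i = 0 can be split off *)
      then have M: "\<And>i. i \<ge> Suc M \<Longrightarrow> (Lop V V 1 ^^ i) v = 0" by simp
      show ?thesis
        unfolding vanishes_on_modes_def
      proof (intro allI impI)
        fix w m assume m: "m \<le> - 2 * int n - 2"
        (* chosen so that the term i = 0 of the expansion below is the residue at m *)
        define j where "j = m - 2 * h + 1"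
        have lower: "binom_shift sU 1 (h + int n) (matrix_coeff ((Lop V V 1 ^^ Suc i) v) w)
            (j + (2 * h - 1 - int (Suc i))) = 0" for i
        proof -
          let ?b = "matrix_coeff ((Lop V V 1 ^^ Suc i) v) w" and ?h = "h - int (Suc i)"
          have "(Lop V V 1 ^^ Suc i) v \<in> weight_space V ?h"
            by (rule weight_space_L1_power[OF less.prems])
          then have ann: "vanishes_on_modes n ?h ((Lop V V 1 ^^ Suc i) v)"
            by (rule less.hyps[rotated]) (use False in simp)
          have "binom_shift sU 1 (?h + int n + int (Suc i)) ?b (j + (2 * h - 1 - int (Suc i))) = 0"
          proof (rule U.binom_shift_vanishing_add[OF bounded_above_matrix_coeff])
            fix m assume "m \<le> - 2 * int n - 2"
            then show "binom_shift sU 1 (?h + int n) ?b m = 0"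
              using ann unfolding vanishes_on_modes_def by blast
          qed (use m in \<open>simp add: j_def\<close>)
          then show ?thesis by simp
        qed
        have "binom_shift sU 1 (h + int n) (opposite_coeff v w) j = 0"
          using * less.prems m unfolding clears_poles_iff U.clears_def by (simp add: j_def)
        moreover have "binom_shift sU 1 (h + int n) (opposite_coeff v w) j
            = (\<Sum>i<Suc M. sU ((- 1) powi h / fact i) (binom_shift sU 1 (h + int n)
                (matrix_coeff ((Lop V V 1 ^^ i) v) w) (j + (2 * h - 1 - int i))))"
          by (rule binom_shift_opposite_coeff[OF less.prems]) (rule M)
        ultimately have "sU ((- 1) powi h) (binom_shift sU 1 (h + int n) (matrix_coeff v w) (j + (2 * h - 1))) = 0"
          unfolding sum.lessThan_Suc_shift lower by simp
        then show "binom_shift sU 1 (h + int n) (matrix_coeff v w) m = 0"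
          by (simp add: j_def)
      qed
    qed
  qed
  then show "\<forall>h. \<forall>v\<in>weight_space V h. vanishes_on_modes n h v" by blast
qed

section \<open>The spaces Omega of the two module structures\<close>

lemma clears_poles_rectangle:
  "clears_poles V W sU f v k l \<Longrightarrow> clears_poles V W sU f v k' l' \<Longrightarrow> clears_poles V W sU f v k l'"
  unfolding clears_poles_iff using U.clears_rectangle[OF bounded_above_opposite_coeff] by blast

text \<open>The mode \<open>v\<^sub>h\<^sub>+\<^sub>m\<close> is the coefficient of \<open>x\<^sup>-\<^sup>h\<^sup>-\<^sup>m\<^sup>-\<^sup>1\<close>, so the condition defining \<open>\<Omega>\<^sub>n\<close> concerns the
  exponents below \<open>-(h + n)\<close>.\<close>
lemma coeffs_vanish_iff:
  fixes h :: int and b :: "'w \<Rightarrow> int \<Rightarrow> 'u"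
  shows "(\<forall>m\<ge>int n. (\<lambda>w. b w (- (h + m) - 1)) = 0) \<longleftrightarrow> (\<forall>w. \<forall>j < - (h + int n). b w j = 0)"
proof
  assume *: "\<forall>m\<ge>int n. (\<lambda>w. b w (- (h + m) - 1)) = 0"
  show "\<forall>w. \<forall>j < - (h + int n). b w j = 0"
  proof (intro allI impI)
    fix w j assume "j < - (h + int n)"
    then have "(\<lambda>w. b w j) = 0" using *[rule_format, of "- j - h - 1"] by simp
    then show "b w j = 0" by (metis zero_fun_apply)
  qed
qed (simp add: fun_eq_iff)

text \<open>By \<open>clears_poles_rectangle\<close> the bound \<open>h + n\<close> at the pole \<open>-1\<close> can be tested with any exponent \<open>l\<close>
  that clears the pole at \<open>0\<close>, so the exponent picked by the choice operator in \<^const>\<open>YL\<close> may be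
  replaced by an arbitrary one.\<close>
lemma YL_vanishes_iff:
  assumes "f \<in> DP V W sU"
  shows "(\<forall>m\<ge>int n. YL V W sU v (h + m) f = 0)
     \<longleftrightarrow> (\<exists>l::nat. clears_poles V W sU f v (h + int n) (int l))"
proof -
  define l where "l = (SOME l::nat. \<exists>k::nat. clears_poles V W sU f v (int k) (int l))"
  have "\<exists>l k :: nat. clears_poles V W sU f v (int k) (int l)"
    using assms unfolding DP_def by blast
  then obtain k :: nat where kl: "clears_poles V W sU f v (int k) (int l)"
    unfolding l_def by (metis (mono_tags, lifting) someI_ex)
  have subst: "f \<circ> series_subst (scl W) (- 1) (Yo V W v w) = series_subst sU (- 1) (opposite_coeff v w)" for w
  proof
    fix j
    show "(f \<circ> series_subst (scl W) (- 1) (Yo V W v w)) j = series_subst sU (- 1) (opposite_coeff v w) j"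
      unfolding opposite_coeff_def comp_apply[of f "series_subst (scl W) (- 1) (Yo V W v w)"]
        W.series_subst_minus_1 U.series_subst_minus_1
      by (rule linear_binom_shift[OF linear bounded_above_Yo])
  qed
  have "(\<forall>m\<ge>int n. YL V W sU v (h + m) f = 0) \<longleftrightarrow> (\<forall>w. \<forall>j < - (h + int n).
      series_mult sU (plus_x_pow (- 1) (- int l)) (series_mult sU (x_plus_pow (- 1) (int l))
        (series_subst sU (- 1) (opposite_coeff v w))) j = 0)"
    unfolding YL_def l_def[symmetric] Let_def subst by (rule coeffs_vanish_iff)
  also have "\<dots> \<longleftrightarrow> clears_poles V W sU f v (h + int n) (int l)"
    using kl U.left_expansion_vanishing_iff_clears[OF bounded_above_opposite_coeff]
    unfolding clears_poles_iff by blast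
  also have "\<dots> \<longleftrightarrow> (\<exists>l::nat. clears_poles V W sU f v (h + int n) (int l))"
    using clears_poles_rectangle kl by blast
  finally show ?thesis .
qed

text \<open>The mirror image of the previous lemma, with the roles of the two poles exchanged.\<close>
lemma YR_vanishes_iff:
  assumes "f \<in> DP V W sU"
  shows "(\<forall>m\<ge>int n. YR V W sU v (h + m) f = 0)
     \<longleftrightarrow> (\<exists>k::nat. clears_poles V W sU f v (int k) (h + int n))"
proof -
  define k where "k = (SOME k::nat. \<exists>l::nat. clears_poles V W sU f v (int k) (int l))"
  have "\<exists>k l :: nat. clears_poles V W sU f v (int k) (int l)"
    using assms unfolding DP_def by blast
  then obtain l :: nat where kl: "clears_poles V W sU f v (int k) (int l)"
    unfolding k_def by (metis (mono_tags, lifting) someI_ex)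
  have "(\<forall>m\<ge>int n. YR V W sU v (h + m) f = 0) \<longleftrightarrow> (\<forall>w. \<forall>j < - (h + int n).
      series_mult sU (plus_x_pow 1 (- int k)) (series_mult sU (x_plus_pow 1 (int k))
        (opposite_coeff v w)) j = 0)"
    unfolding YR_def k_def[symmetric] Let_def opposite_coeff_def by (rule coeffs_vanish_iff)
  also have "\<dots> \<longleftrightarrow> clears_poles V W sU f v (int k) (h + int n)"
    using kl U.right_expansion_vanishing_iff_clears unfolding clears_poles_iff by blast
  also have "\<dots> \<longleftrightarrow> (\<exists>k::nat. clears_poles V W sU f v (int k) (h + int n))"
    using clears_poles_rectangle kl by blast
  finally show ?thesis .
qed

text \<open>A general \<open>v\<close> has finitely many homogeneous components, so one exponent dominates
  \<open>h + n\<close> for all of them.\<close>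
lemma DP_if_clears_poles:
  assumes "\<And>h v. v \<in> weight_space V h \<Longrightarrow> clears_poles V W sU f v (h + int n) (h + int n)"
  shows "f \<in> DP V W sU"
proof -
  have "\<exists>k::nat. clears_poles V W sU f v (int k) (int k)" for v
  proof -
    obtain c where c: "homogeneous_decomposition c v" using homogeneous_decomposition_exists by blast
    let ?S = "{h. c h \<noteq> 0}"
    have fin: "finite ?S" and hom: "\<And>h. c h \<in> weight_space V h"
      using c by (simp_all add: homogeneous_decomposition_def)
    (* Any common upper bound of the h + n serves; truncation to nat allows for negative h + n. *)
    define K where "K = (\<Sum>h\<in>?S. nat (h + int n))"
    have "h + int n \<le> int K" if "h \<in> ?S" for h
    proof -
      have "nat (h + int n) \<le> K"
        unfolding K_def by (rule member_le_sum[OF that _ fin]) simp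
      then show ?thesis by linarith
    qed
    then have comp: "U.clears (int K) (int K) (opposite_coeff (c h) w)" if "h \<in> ?S" for h w
      using assms[OF hom[of h]] that unfolding clears_poles_iff
      by (meson U.clears_mono_left U.clears_mono_right bounded_above_opposite_coeff)
    have "opposite_coeff v w = (\<lambda>k. \<Sum>h\<in>?S. opposite_coeff (c h) w k)" for w
      by (rule ext) (simp add: opposite_coeff_def Yo_decomposition[OF c] f.sum)
    then have "U.clears (int K) (int K) (opposite_coeff v w)" for w
      using U.clears_sum[OF fin bounded_above_opposite_coeff comp] by simp
    then show ?thesis unfolding clears_poles_iff by blast
  qed
  then show ?thesis unfolding DP_def using linear by blast
qed

text \<open>\<open>Y\<^sup>L\<close> bounds the pole at \<open>-1\<close> and \<open>Y\<^sup>R\<close> bounds the pole at \<open>0\<close>; \<open>clears_poles_rectangle\<close> joins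
  \<open>(h+n, l)\<close> and \<open>(k, h+n)\<close> to \<open>(h+n, h+n)\<close>, and conversely splits \<open>(h+n, h+n)\<close> with the help of any
  admissible \<open>(k, l)\<close>.\<close>
lemma Omega_iff_clears_poles:
  "f \<in> Omega V n (DP V W sU) (YL V W sU) \<inter> Omega V n (DP V W sU) (YR V W sU)
   \<longleftrightarrow> (\<forall>h. \<forall>v\<in>weight_space V h. clears_poles V W sU f v (h + int n) (h + int n))"
proof
  assume "f \<in> Omega V n (DP V W sU) (YL V W sU) \<inter> Omega V n (DP V W sU) (YR V W sU)"
  then have DP: "f \<in> DP V W sU"
    and L: "\<And>h v. v \<in> weight_space V h \<Longrightarrow> \<forall>m\<ge>int n. YL V W sU v (h + m) f = 0"
    and R: "\<And>h v. v \<in> weight_space V h \<Longrightarrow> \<forall>m\<ge>int n. YR V W sU v (h + m) f = 0"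
    by (simp_all add: Omega_def)
  show "\<forall>h. \<forall>v\<in>weight_space V h. clears_poles V W sU f v (h + int n) (h + int n)"
    using L[unfolded YL_vanishes_iff[OF DP]] R[unfolded YR_vanishes_iff[OF DP]]
      clears_poles_rectangle by blast
next
  assume *: "\<forall>h. \<forall>v\<in>weight_space V h. clears_poles V W sU f v (h + int n) (h + int n)"
  then have DP: "f \<in> DP V W sU" by (intro DP_if_clears_poles) blast
  then have "\<exists>k l :: nat. clears_poles V W sU f v (int k) (int l)" for v
    unfolding DP_def by blast
  then have LR: "(\<exists>l::nat. clears_poles V W sU f v (h + int n) (int l))
      \<and> (\<exists>k::nat. clears_poles V W sU f v (int k) (h + int n))" if "v \<in> weight_space V h" for h v
    using * that clears_poles_rectangle by blast
  then show "f \<in> Omega V n (DP V W sU) (YL V W sU) \<inter> Omega V n (DP V W sU) (YR V W sU)"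
    using DP LR[folded YL_vanishes_iff[OF DP] YR_vanishes_iff[OF DP]] by (simp add: Omega_def)
qed

end

section \<open>The two descriptions of Hom(W/O', U)\<close>

theorem proposition3p11:
  fixes V :: "'v::ab_group_add voa"
    and W :: "('v, 'w::ab_group_add) vmodule"
    and sU :: "complex \<Rightarrow> 'u \<Rightarrow> 'u::ab_group_add"
    and n :: nat
  assumes "vertex_operator_algebra V"
    and "weak_module V W"
    and "vector_space sU"
  shows "Hom_A' V W sU n =
           Omega V n (DP V W sU) (YL V W sU) \<inter> Omega V n (DP V W sU) (YR V W sU) \<and>
         Hom_A' V W sU n =
           {\<alpha>. Vector_Spaces.linear (scl W) sU \<alpha> \<and>
               (\<forall>h. \<forall>v\<in>weight_space V h.
                  clears_poles V W sU \<alpha> v (h + int n) (h + int n))}"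
proof -
  have hom: "hom_from_module V W sU \<alpha>" if "Vector_Spaces.linear (scl W) sU \<alpha>" for \<alpha>
    by (intro hom_from_module.intro hom_from_module_axioms.intro voa_module.intro
        voa_module_axioms.intro voa.intro assms that)
  have "Hom_A' V W sU n = {\<alpha>. Vector_Spaces.linear (scl W) sU \<alpha> \<and>
      (\<forall>h. \<forall>v\<in>weight_space V h. clears_poles V W sU \<alpha> v (h + int n) (h + int n))}"
    unfolding Hom_A'_def using hom_from_module.vanishes_on_O'_iff_clears_poles[OF hom] by blast
  moreover have "Omega V n (DP V W sU) (YL V W sU) \<inter> Omega V n (DP V W sU) (YR V W sU)
      = {\<alpha>. Vector_Spaces.linear (scl W) sU \<alpha> \<and>
      (\<forall>h. \<forall>v\<in>weight_space V h. clears_poles V W sU \<alpha> v (h + int n) (h + int n))}"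
  proof -
    have "Vector_Spaces.linear (scl W) sU \<alpha>" if "\<alpha> \<in> Omega V n (DP V W sU) (YL V W sU)" for \<alpha>
      using that by (simp add: Omega_def DP_def)
    then show ?thesis using hom_from_module.Omega_iff_clears_poles[OF hom] by blast
  qed
  ultimately show ?thesis by simp
qed

end
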